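(* Let $(W,S)$ be a finite Coxeter system, $Q=q_1\cdots q_m$ a word on $S$, and $\rho\in W$ such that the subword complex $\mathcal{SC}(Q,\rho)$ is double root free. Then there is at most one $\mathsf p$-falling (resp. $\mathsf n$-falling) path in the increasing flip graph $\mathcal G(Q,\rho)$ between any two facets $I$ and $J$ of $\mathcal{SC}(Q,\rho)$ (from $I$ to $J$). If it exists, its length is given by $|I\setminus J|=|J\setminus I|$.
   Context: Let $(W,S)$ be a finite Coxeter system acting by reflections on a Euclidean space $V$, with length function $\ell$, root system $\Phi$ and simple roots $\{\alpha_s: s\in S\}$. Let $Q=q_1q_2\cdots q_m$ be a word in the letters $S$ and $\rho\in W$; write $[m]=\{1,\dots,m\}$. The subword complex $\mathcal{SC}(Q,\rho)$ is the simplicial complex whose facets are the sets $I\subseteq[m]$ such that the letters of $Q$ at the positions in $[m]\setminus I$, read in increasing order of position, form a reduced expression of $\rho$. The root function of a facet $I$ is $\mathsf r(I,k)=w(\alpha_{q_k})\in\Phi$ for $k\in[m]$, where $w$ is the product of the $q_x$, $x\in[k-1]\setminus I$, in increasing order of position. Two distinct facets $I,J$ are adjacent if $I\setminus\{i\}=J\setminus\{j\}$ for some $i\in I$, $j\in J$; then $i$ is called flippable in $I$. The flip from $I$ to $J$ is increasing if $i<j$. The increasing flip graph $\mathcal G(Q,\rho)$ is the directed graph whose vertices are the facets and whose edges $I\to J$ are the increasing flips. For an edge $I\to J$ with $I\setminus\{i\}=J\setminus\{j\}$, $i<j$, set $\mathsf p(I\to J)=i$ and $\mathsf n(I\to J)=j$.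 A path is $\mathsf p$-falling (resp. $\mathsf n$-falling) if the sequence of $\mathsf p$-labels (resp. $\mathsf n$-labels) of its successive edges is weakly decreasing; its length is its number of edges. The subword complex has a double root if there is a facet $I$ and two distinct positions $i\neq j$, both flippable in $I$, with $\mathsf r(I,i)=\mathsf r(I,j)$; otherwise it is double root free. *)

theory Defs
  imports
    "HOL-Algebra.Group"
    "HOL-Analysis.Linear_Algebra"
    "Graph_Theory.Arc_Walk"
begin

section \<open>Coxeter systems\<close>

definition word_prod :: "('w, 'b) monoid_scheme \<Rightarrow> 'w list \<Rightarrow> 'w" where
  "word_prod W ws = foldr (\<otimes>\<^bsub>W\<^esub>) ws \<one>\<^bsub>W\<^esub>"

text \<open>An entry \<^term>\<open>0::nat\<close> of a Coxeter matrix stands for infinity: the relation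
  \<open>(s t)\<^sup>0 = 1\<close> imposes nothing.\<close>

definition coxeter_matrix :: "'w set \<Rightarrow> ('w \<Rightarrow> 'w \<Rightarrow> nat) \<Rightarrow> bool" where
  "coxeter_matrix S M \<longleftrightarrow>
     (\<forall>s\<in>S. M s s = 1) \<and>
     (\<forall>s\<in>S. \<forall>t\<in>S. M s t = M t s \<and> (s \<noteq> t \<longrightarrow> M s t \<noteq> 1))"

text \<open>The congruence on words over \<open>S\<close> generated by \<open>(s t)\<^sup>M\<^sup>s\<^sup>t \<sim> []\<close>. As \<open>M s s = 1\<close> gives
  \<open>s s \<sim> []\<close>, the quotient of the free monoid by it is already a group, namely the one
  presented by \<open>M\<close>.\<close>

inductive coxeter_cong :: "'w set \<Rightarrow> ('w \<Rightarrow> 'w \<Rightarrow> nat) \<Rightarrow> 'w list \<Rightarrow> 'w list \<Rightarrow> bool"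
  for S :: "'w set" and M :: "'w \<Rightarrow> 'w \<Rightarrow> nat" where
  rel: "\<lbrakk>s \<in> S; t \<in> S; u \<in> lists S; v \<in> lists S\<rbrakk>
        \<Longrightarrow> coxeter_cong S M (u @ concat (replicate (M s t) [s, t]) @ v) (u @ v)"
| refl: "u \<in> lists S \<Longrightarrow> coxeter_cong S M u u"
| sym: "coxeter_cong S M u v \<Longrightarrow> coxeter_cong S M v u"
| trans: "coxeter_cong S M u v \<Longrightarrow> coxeter_cong S M v w \<Longrightarrow> coxeter_cong S M u w"

locale coxeter_system = group W for W :: "('w, 'b) monoid_scheme" (structure) +
  fixes S :: "'w set"
  assumes generators_closed: "S \<subseteq> carrier W"
    and generated: "carrier W = word_prod W ` lists S"
    and presentation:
      "\<exists>M. coxeter_matrix S M \<and>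
         (\<forall>u\<in>lists S. \<forall>v\<in>lists S. word_prod W u = word_prod W v \<longleftrightarrow> coxeter_cong S M u v)"

definition coxeter_length :: "('w, 'b) monoid_scheme \<Rightarrow> 'w set \<Rightarrow> 'w \<Rightarrow> nat" where
  "coxeter_length W S w = (LEAST n. \<exists>ws\<in>lists S. word_prod W ws = w \<and> length ws = n)"

definition reduced_expression :: "('w, 'b) monoid_scheme \<Rightarrow> 'w set \<Rightarrow> 'w list \<Rightarrow> 'w \<Rightarrow> bool" where
  "reduced_expression W S ws w \<longleftrightarrow>
     ws \<in> lists S \<and> word_prod W ws = w \<and> length ws = coxeter_length W S w"


section \<open>Finite Coxeter systems acting by reflections\<close>

definition reflection :: "'v::real_inner \<Rightarrow> 'v \<Rightarrow> 'v" where
  "reflection a x = x - (2 * (x \<bullet> a) / (a \<bullet> a)) *\<^sub>R a"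

text \<open>\<open>act\<close> identifies \<open>W\<close> with a group of isometries of the Euclidean space. The root system
  \<open>\<Phi>\<close> is a \<open>W\<close>-stable choice of two opposite normal vectors for each hyperplane whose
  reflection lies in \<open>W\<close>, so it is reduced but not required to be crystallographic. The roots
  need not span the space; the simple roots form a basis of their span.\<close>

locale finite_coxeter_reflection_system = coxeter_system W S
  for W :: "('w, 'b) monoid_scheme" (structure) and S :: "'w set" +
  fixes act :: "'w \<Rightarrow> 'v::euclidean_space \<Rightarrow> 'v"
    and \<Phi> :: "'v set"
    and \<alpha> :: "'w \<Rightarrow> 'v"
  assumes finite_group: "finite (carrier W)"
    and act_isometry: "w \<in> carrier W \<Longrightarrow> orthogonal_transformation (act w)"
    and act_mult: "\<lbrakk>v \<in> carrier W; w \<in> carrier W\<rbrakk> \<Longrightarrow> act (v \<otimes> w) = act v \<circ> act w"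
    and act_faithful: "inj_on act (carrier W)"
    and root_nonzero: "0 \<notin> \<Phi>"
    and root_stable: "\<lbrakk>w \<in> carrier W; \<beta> \<in> \<Phi>\<rbrakk> \<Longrightarrow> act w \<beta> \<in> \<Phi>"
    and root_line: "\<beta> \<in> \<Phi> \<Longrightarrow> \<Phi> \<inter> span {\<beta>} = {\<beta>, - \<beta>}"
    and root_reflection: "\<beta> \<in> \<Phi> \<Longrightarrow> \<exists>w\<in>carrier W. act w = reflection \<beta>"
    and reflection_root:
      "\<lbrakk>w \<in> carrier W; a \<noteq> 0; act w = reflection a\<rbrakk> \<Longrightarrow> \<exists>\<beta>\<in>\<Phi>. \<beta> \<in> span {a}"
    and simple_root: "s \<in> S \<Longrightarrow> \<alpha> s \<in> \<Phi>"
    and simple_reflection: "s \<in> S \<Longrightarrow> act s = reflection (\<alpha> s)"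
    and simple_independent: "independent (\<alpha> ` S)"
    and simple_sign:
      "\<beta> \<in> \<Phi> \<Longrightarrow> \<exists>c. (\<forall>s\<in>S. 0 \<le> c s) \<and>
         (\<beta> = (\<Sum>s\<in>S. c s *\<^sub>R \<alpha> s) \<or> \<beta> = - (\<Sum>s\<in>S. c s *\<^sub>R \<alpha> s))"


section \<open>Subword complexes\<close>

text \<open>Positions of a word are the list indices \<open>0, \<dots>, length Q - 1\<close>, i.e. they are shifted by
  one with respect to \<open>{1, \<dots>, m}\<close>.\<close>

definition sc_facets :: "('w, 'b) monoid_scheme \<Rightarrow> 'w set \<Rightarrow> 'w list \<Rightarrow> 'w \<Rightarrow> nat set set" where
  "sc_facets W S Q \<rho> =
     {I. I \<subseteq> {..<length Q} \<and> reduced_expression W S (nths Q ({..<length Q} - I)) \<rho>}"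

definition root_function ::
  "('w, 'b) monoid_scheme \<Rightarrow> ('w \<Rightarrow> 'v \<Rightarrow> 'v) \<Rightarrow> ('w \<Rightarrow> 'v) \<Rightarrow> 'w list \<Rightarrow> nat set \<Rightarrow> nat \<Rightarrow> 'v" where
  "root_function W act \<alpha> Q I k = act (word_prod W (nths Q ({..<k} - I))) (\<alpha> (Q ! k))"

definition is_flip :: "nat set \<Rightarrow> nat \<Rightarrow> nat set \<Rightarrow> nat \<Rightarrow> bool" where
  "is_flip I i J j \<longleftrightarrow> I \<noteq> J \<and> i \<in> I \<and> j \<in> J \<and> I - {i} = J - {j}"

definition flippable ::
  "('w, 'b) monoid_scheme \<Rightarrow> 'w set \<Rightarrow> 'w list \<Rightarrow> 'w \<Rightarrow> nat set \<Rightarrow> nat \<Rightarrow> bool" where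
  "flippable W S Q \<rho> I i \<longleftrightarrow> (\<exists>J\<in>sc_facets W S Q \<rho>. \<exists>j. is_flip I i J j)"

definition has_double_root ::
  "('w, 'b) monoid_scheme \<Rightarrow> 'w set \<Rightarrow> ('w \<Rightarrow> 'v \<Rightarrow> 'v) \<Rightarrow> ('w \<Rightarrow> 'v) \<Rightarrow> 'w list \<Rightarrow> 'w \<Rightarrow> bool" where
  "has_double_root W S act \<alpha> Q \<rho> \<longleftrightarrow>
     (\<exists>I\<in>sc_facets W S Q \<rho>. \<exists>i j. i \<noteq> j \<and> flippable W S Q \<rho> I i \<and> flippable W S Q \<rho> I j \<and>
        root_function W act \<alpha> Q I i = root_function W act \<alpha> Q I j)"

abbreviation double_root_free ::
  "('w, 'b) monoid_scheme \<Rightarrow> 'w set \<Rightarrow> ('w \<Rightarrow> 'v \<Rightarrow> 'v) \<Rightarrow> ('w \<Rightarrow> 'v) \<Rightarrow> 'w list \<Rightarrow> 'w \<Rightarrow> bool" where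
  "double_root_free W S act \<alpha> Q \<rho> \<equiv> \<not> has_double_root W S act \<alpha> Q \<rho>"


section \<open>The increasing flip graph\<close>

definition increasing_flip_graph ::
  "('w, 'b) monoid_scheme \<Rightarrow> 'w set \<Rightarrow> 'w list \<Rightarrow> 'w \<Rightarrow> (nat set, nat set \<times> nat set) pre_digraph"
  where
  "increasing_flip_graph W S Q \<rho> =
     \<lparr>verts = sc_facets W S Q \<rho>,
      arcs = {(I, J). I \<in> sc_facets W S Q \<rho> \<and> J \<in> sc_facets W S Q \<rho> \<and>
                (\<exists>i j. is_flip I i J j \<and> i < j)},
      tail = fst, head = snd\<rparr>"

text \<open>For an arc \<open>(I, J)\<close> the pair \<open>(i, j)\<close> is unique: \<open>I - J = {i}\<close> and \<open>J - I = {j}\<close>.\<close>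

definition p_label :: "nat set \<times> nat set \<Rightarrow> nat" where
  "p_label e = (THE i. \<exists>j. is_flip (fst e) i (snd e) j)"

definition n_label :: "nat set \<times> nat set \<Rightarrow> nat" where
  "n_label e = (THE j. \<exists>i. is_flip (fst e) i (snd e) j)"

text \<open>A path is the list of its arcs, so that its \<^const>\<open>length\<close> is its number of edges; it may
  be empty. Since increasing flips raise the sum of the positions, the graph is acyclic, and
  walks and paths in it are the same.\<close>

definition falling_path ::
  "(nat set \<times> nat set \<Rightarrow> nat) \<Rightarrow> ('w, 'b) monoid_scheme \<Rightarrow> 'w set \<Rightarrow> 'w list \<Rightarrow> 'w \<Rightarrow>
     nat set \<Rightarrow> (nat set \<times> nat set) list \<Rightarrow> nat set \<Rightarrow> bool" where
  "falling_path lab W S Q \<rho> I \<pi> J \<longleftrightarrow>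
     pre_digraph.awalk (increasing_flip_graph W S Q \<rho>) I \<pi> J \<and>
     sorted_wrt (\<ge>) (map lab \<pi>)"

abbreviation "p_falling_path \<equiv> falling_path p_label"
abbreviation "n_falling_path \<equiv> falling_path n_label"

end

theory Submission
  imports Defs
begin

text \<open>Flipping a position \<open>p\<close> never changes the root function before \<open>p\<close>, so the last edge of a
  \<open>p\<close>-falling path from \<open>I\<close> to \<open>J\<close> flips out the minimum of \<open>I - J\<close>, and by double root freeness
  there is only one position of \<open>J\<close> it can flip in; this gives uniqueness.

  For the length one has to exclude that a position \<open>x\<close> flipped out earlier is flipped in again by
  the last edge. All positions flipped out have positive roots in \<open>I\<close> and are flippable there; let
  \<open>D\<close> be the rest of \<open>I\<close>. Then \<open>\<rho>\<close> is the Demazure product of the letters outside \<open>D\<close>, so in every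
  facet containing \<open>D\<close> all positions outside \<open>D\<close> are flippable, and \<open>I\<close> is the only facet containing
  \<open>D\<close> and \<open>x\<close> without decreasing flips outside them. In the absence of double roots, an increasing
  flip cannot make the root of a common flippable position change from positive to negative. But the
  root of \<open>x\<close> is negative in \<open>J\<close>, hence stays negative along decreasing flips fixing \<open>x\<close> and \<open>D\<close>,
  which end in \<open>I\<close>, where it is positive. The case of \<open>n\<close>-falling paths is dual.\<close>

section \<open>Reflections and their words\<close>

lemma linear_reflection: "linear (reflection a)"
  by (rule linearI) (simp_all add: reflection_def algebra_simps add_divide_distrib)

lemma reflection_self [simp]: "reflection a a = - a"
  by (cases "a = 0") (simp_all add: reflection_def scaleR_2)

lemma reflection_minus [simp]: "reflection a (- x) = - reflection a x"
  by (simp add: reflection_def)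

lemma reflection_uminus [simp]: "reflection (- a) = reflection a"
  by (rule ext) (simp add: reflection_def)

lemma inner_reflection_left: "reflection a x \<bullet> y = x \<bullet> reflection a y"
  by (simp add: reflection_def inner_diff_left inner_diff_right inner_commute)

lemma reflection_involution [simp]: "reflection a (reflection a x) = x"
proof (cases "a = 0")
  case False
  have "reflection a (reflection a x) =
      x - (2 * (x \<bullet> a) / (a \<bullet> a)) *\<^sub>R a - (2 * ((x - (2 * (x \<bullet> a) / (a \<bullet> a)) *\<^sub>R a) \<bullet> a) / (a \<bullet> a)) *\<^sub>R a"
    by (simp add: reflection_def)
  also have "2 * ((x - (2 * (x \<bullet> a) / (a \<bullet> a)) *\<^sub>R a) \<bullet> a) / (a \<bullet> a) = - (2 * (x \<bullet> a) / (a \<bullet> a))"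
    using False by (simp add: inner_diff_left)
  finally show ?thesis by simp
qed (simp add: reflection_def)

lemma reflection_isometry [simp]: "reflection a x \<bullet> reflection a y = x \<bullet> y"
  by (simp add: inner_reflection_left)

lemma reflection_conjugate:
  assumes "linear g" and "\<And>x y. g x \<bullet> g y = x \<bullet> y"
  shows "g (reflection a x) = reflection (g a) (g x)"
  using assms(1) by (simp add: reflection_def linear_diff linear_scale assms(2))

lemma reflection_decreases:
  assumes "l \<bullet> b > 0" and "v \<bullet> b > 0"
  shows "l \<bullet> reflection b v < l \<bullet> v"
proof -
  have "b \<bullet> b > 0" using assms(1) by auto
  then have "2 * (v \<bullet> b) / (b \<bullet> b) * (l \<bullet> b) > 0" using assms by simp
  then show ?thesis by (simp add: reflection_def inner_diff_right)
qed

lemma reflection_eqD: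
  assumes "reflection a = reflection b"
  shows "\<exists>c. b = c *\<^sub>R a"
proof -
  have "reflection a b = - b" using assms(1) by simp
  then have "2 *\<^sub>R b = 2 *\<^sub>R (((b \<bullet> a) / (a \<bullet> a)) *\<^sub>R a)"
    by (simp add: reflection_def scaleR_2 algebra_simps)
  then show ?thesis by (metis scaleR_cancel_left zero_neq_numeral)
qed

text \<open>\<open>fold\<close> applies the first entry of \<open>js\<close> first, so
  \<open>rev [0..<k]\<close> gives the operator of the product of the first \<open>k\<close> letters
  and \<open>[0..<k]\<close> its inverse, both with the positions in \<open>I\<close>
  skipped.\<close>

definition run :: "(nat \<Rightarrow> 'v::real_inner) \<Rightarrow> nat set \<Rightarrow> nat list \<Rightarrow> 'v \<Rightarrow> 'v" where
  "run a I js = fold (\<lambda>j v. if j \<in> I then v else reflection (a j) v) js"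

lemma run_Nil [simp]: "run a I [] v = v"
  by (simp add: run_def)

lemma run_Cons [simp]: "run a I (j # js) v = run a I js (if j \<in> I then v else reflection (a j) v)"
  by (simp add: run_def)

lemma run_append [simp]: "run a I (xs @ ys) v = run a I ys (run a I xs v)"
  by (simp add: run_def)

lemma linear_run: "linear (run a I js)"
proof (induction js)
  case Nil
  then show ?case by (intro linearI) simp_all
next
  case (Cons j js)
  have "run a I (j # js) = run a I js \<circ> (\<lambda>v. if j \<in> I then v else reflection (a j) v)"
    by (rule ext) simp
  moreover have "linear (\<lambda>v. if j \<in> I then v else reflection (a j) v)"
    by (cases "j \<in> I") (simp_all add: linear_reflection linear_id[unfolded id_def])
  ultimately show ?case using linear_compose[OF _ Cons.IH] by metis
qed

lemma run_isometry [simp]: "run a I js x \<bullet> run a I js y = x \<bullet> y"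
  by (induction js arbitrary: x y) simp_all

lemma run_rev_run [simp]: "run a I (rev js) (run a I js v) = v"
  by (induction js arbitrary: v) simp_all

lemma run_run_rev [simp]: "run a I js (run a I (rev js) v) = v"
  using run_rev_run[of a I "rev js" v] by simp

lemma run_inject [simp]: "run a I js x = run a I js y \<longleftrightarrow> x = y"
  by (metis run_rev_run)

lemma inner_run_left: "run a I js x \<bullet> y = x \<bullet> run a I (rev js) y"
  by (metis run_isometry run_run_rev)

lemma run_minus [simp]: "run a I js (- x) = - run a I js x"
  by (induction js arbitrary: x) simp_all

lemma run_reflection: "run a I js (reflection b v) = reflection (run a I js b) (run a I js v)"
  by (rule reflection_conjugate[OF linear_run]) simp

lemma run_cong:
  assumes "\<And>j. j \<in> set js \<Longrightarrow> j \<in> I \<longleftrightarrow> j \<in> J"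
  shows "run a I js = run a J js"
proof
  show "run a I js v = run a J js v" for v
    using assms by (induction js arbitrary: v) simp_all
qed

text \<open>A group element \<open>w\<close> is encoded by \<open>w l\<close> with \<open>l\<close> dominant, so that \<open>u \<bullet> b > 0\<close> says that
  multiplying by the reflection in the positive root \<open>b\<close> increases the length; \<open>l \<bullet> u\<close> replaces the
  length as a monotone quantity.\<close>

definition root_step :: "'v::real_inner set \<Rightarrow> 'v \<Rightarrow> 'v \<Rightarrow> 'v \<Rightarrow> bool" where
  "root_step \<Phi> l u v \<longleftrightarrow> (\<exists>b\<in>\<Phi>. l \<bullet> b > 0 \<and> u \<bullet> b > 0 \<and> v = reflection b u)"

abbreviation bruhat :: "'v::real_inner set \<Rightarrow> 'v \<Rightarrow> 'v \<Rightarrow> 'v \<Rightarrow> bool" where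
  "bruhat \<Phi> l \<equiv> (root_step \<Phi> l)\<^sup>*\<^sup>*"

lemma bruhat_decreases:
  assumes "bruhat \<Phi> l u v"
  shows "l \<bullet> v \<le> l \<bullet> u"
  using assms
proof (induction rule: rtranclp_induct)
  case (step y z)
  then have "l \<bullet> z < l \<bullet> y" by (auto simp: root_step_def intro: reflection_decreases)
  then show ?case using step.IH by simp
qed simp

text \<open>The sign of a root is the sign of its inner product with \<open>l\<close>, \<open>R\<close> is the action of \<open>\<rho>\<close>, and
  \<open>N\<close> its length. A root \<open>b\<close> is an inversion of \<open>\<rho>\<close> if \<open>l \<bullet> b > 0\<close> and \<open>R l \<bullet> b < 0\<close>; the latter is
  \<open>R\<^sup>-\<^sup>1 b < 0\<close>.\<close>

locale reflection_word =
  fixes \<Phi> :: "'v::real_inner set" and l :: 'v and m :: nat and a :: "nat \<Rightarrow> 'v"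
    and R :: "'v \<Rightarrow> 'v" and N :: nat
  assumes l_root: "\<beta> \<in> \<Phi> \<Longrightarrow> l \<bullet> \<beta> \<noteq> 0"
    and reflection_closed: "\<lbrakk>\<beta> \<in> \<Phi>; \<gamma> \<in> \<Phi>\<rbrakk> \<Longrightarrow> reflection \<beta> \<gamma> \<in> \<Phi>"
    and root_multiple: "\<lbrakk>\<beta> \<in> \<Phi>; c *\<^sub>R \<beta> \<in> \<Phi>\<rbrakk> \<Longrightarrow> c *\<^sub>R \<beta> = \<beta> \<or> c *\<^sub>R \<beta> = - \<beta>"
    and a_root: "k < m \<Longrightarrow> a k \<in> \<Phi>"
    and a_pos: "k < m \<Longrightarrow> l \<bullet> a k > 0"
    and a_simple: "\<lbrakk>k < m; \<beta> \<in> \<Phi>; l \<bullet> \<beta> > 0; \<beta> \<noteq> a k\<rbrakk> \<Longrightarrow> l \<bullet> reflection (a k) \<beta> > 0"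
    and minimal: "\<lbrakk>I \<subseteq> {..<m}; run a I (rev [0..<m]) = R\<rbrakk> \<Longrightarrow> N \<le> card ({..<m} - I)"
begin

abbreviation pre :: "nat set \<Rightarrow> nat \<Rightarrow> 'v \<Rightarrow> 'v" where
  "pre I k \<equiv> run a I (rev [0..<k])"

definition rt :: "nat set \<Rightarrow> nat \<Rightarrow> 'v" where
  "rt I k = pre I k (a k)"

definition fac :: "nat set \<Rightarrow> bool" where
  "fac I \<longleftrightarrow> I \<subseteq> {..<m} \<and> pre I m = R \<and> card ({..<m} - I) = N"

section \<open>Roots of letters and inversion sets\<close>

lemma uminus_root: "\<beta> \<in> \<Phi> \<Longrightarrow> - \<beta> \<in> \<Phi>"
  using reflection_closed[of \<beta> \<beta>] by simp

lemma run_root: "\<lbrakk>\<beta> \<in> \<Phi>; set js \<subseteq> {..<m}\<rbrakk> \<Longrightarrow> run a I js \<beta> \<in> \<Phi>"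
  by (induction js arbitrary: \<beta>) (simp_all add: reflection_closed a_root)

lemma run_l_root: "\<lbrakk>\<beta> \<in> \<Phi>; set js \<subseteq> {..<m}\<rbrakk> \<Longrightarrow> run a I js l \<bullet> \<beta> \<noteq> 0"
  by (simp add: inner_run_left l_root run_root)

lemma rt_root: "k < m \<Longrightarrow> rt I k \<in> \<Phi>"
  unfolding rt_def by (rule run_root) (auto simp: a_root)

lemma pre_cong: "(\<And>j. j < k \<Longrightarrow> j \<in> I \<longleftrightarrow> j \<in> J) \<Longrightarrow> pre I k = pre J k"
  by (rule run_cong) auto

lemma rt_cong: "(\<And>j. j < k \<Longrightarrow> j \<in> I \<longleftrightarrow> j \<in> J) \<Longrightarrow> rt I k = rt J k"
  unfolding rt_def using pre_cong[of k I J] by simp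

text \<open>Inserting a letter \<open>s\<close> into a product \<open>u v\<close> gives
  \<open>u s v = (u s u^-1) u v\<close>, and \<open>u s u^-1\<close> is the reflection in
  \<open>rt F i\<close>.\<close>

lemma pre_remove:
  assumes "i \<in> F"
  shows "pre (F - {i}) k v = (if i < k then reflection (rt F i) (pre F k v) else pre F k v)"
proof (induction k arbitrary: v)
  case (Suc k)
  consider "k < i" | "k = i" | "i < k" by linarith
  then show ?case
  proof cases
    case 2
    have "pre (F - {i}) (Suc k) v = pre F i (reflection (a i) v)"
      using Suc.IH 2 by simp
    then show ?thesis using 2 assms by (simp add: rt_def run_reflection)
  qed (use Suc.IH in auto)
qed simp

text \<open>A simple reflection makes only its own simple root negative among the positive roots. So
  \<beta> changes sign at a used letter whose simple root is the pullback of \<beta>.\<close>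

lemma crossing:
  assumes "k \<le> m" and "\<beta> \<in> \<Phi>" and "l \<bullet> \<beta> > 0" and "pre I k l \<bullet> \<beta> < 0"
  shows "\<exists>e<k. e \<notin> I \<and> rt I e = \<beta>"
  using assms(1,4)
proof (induction k)
  case 0
  then show ?case using assms(3) by simp
next
  case (Suc k)
  show ?case
  proof (cases "pre I k l \<bullet> \<beta> < 0")
    case True
    then show ?thesis using Suc by (meson Suc_leD less_Suc_eq)
  next
    case False
    define \<gamma> where "\<gamma> = run a I [0..<k] \<beta>"
    have \<gamma>: "\<gamma> \<in> \<Phi>" unfolding \<gamma>_def using Suc.prems assms(2) by (intro run_root) auto
    have \<beta>: "\<beta> = pre I k \<gamma>" by (simp add: \<gamma>_def)
    have "k \<notin> I" using False Suc.prems by auto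
    then have "l \<bullet> reflection (a k) \<gamma> < 0"
      using Suc.prems by (simp add: \<beta> inner_reflection_left)
    moreover have "l \<bullet> \<gamma> > 0" using False l_root[OF \<gamma>] by (simp add: \<beta>)
    ultimately have "\<gamma> = a k" using a_simple[of k \<gamma>] \<gamma> Suc.prems by force
    then show ?thesis using \<open>k \<notin> I\<close> \<beta> by (auto simp: rt_def)
  qed
qed

text \<open>The deletion property: by \<open>crossing\<close>, a negative root of a used letter is
  opposite to the root of an earlier one, and deleting both letters keeps the product, against
  \<open>minimal\<close>.\<close>

lemma fac_pos:
  assumes "fac I" and "k < m" and "k \<notin> I"
  shows "l \<bullet> rt I k > 0"
proof (rule ccontr)
  assume "\<not> ?thesis"
  then have neg: "l \<bullet> rt I k < 0" using l_root[OF rt_root, of k I] assms(2) by linarith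
  have "pre I k l \<bullet> - rt I k < 0" using a_pos[OF assms(2)] by (simp add: rt_def)
  then obtain e where e: "e < k" "e \<notin> I" "rt I e = - rt I k"
    using crossing[of k "- rt I k" I] neg assms(2) uminus_root[OF rt_root[OF assms(2)]] by auto
  define K where "K = insert k I"
  define L where "L = insert e K"
  have I: "K - {k} = I" "k \<in> K" and K: "L - {e} = K" "e \<in> L" using assms e by (auto simp: K_def L_def)
  have r: "rt K k = rt I k" by (rule rt_cong) (auto simp: K_def)
  have r': "rt L e = rt I e" by (rule rt_cong) (use e in \<open>auto simp: K_def L_def\<close>)
  have "pre I m v = pre L m v" for v
  proof -
    have "pre I m v = reflection (rt K k) (pre K m v)"
      using pre_remove[of k K m v] assms(2) I by simp
    also have "pre K m v = reflection (rt L e) (pre L m v)"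
      using pre_remove[of e L m v] assms(2) e(1) K by simp
    finally show ?thesis using r r' e by simp
  qed
  then have "pre L m = R" using assms(1) by (auto simp: fac_def)
  moreover have "L \<subseteq> {..<m}" using assms e by (auto simp: L_def K_def fac_def)
  ultimately have "N \<le> card ({..<m} - L)" using minimal by blast
  moreover have "card ({..<m} - L) < card ({..<m} - I)"
    by (rule psubset_card_mono) (use assms in \<open>auto simp: L_def K_def\<close>)
  ultimately show False using assms(1) by (simp add: fac_def)
qed

text \<open>To lose the inversion \<beta> again, a later letter would need the root
  \<open>- \<beta>\<close>, which \<open>fac_pos\<close> forbids.\<close>

lemma sign_mono:
  assumes "fac I" and "\<beta> \<in> \<Phi>" and "l \<bullet> \<beta> > 0" and "pre I k l \<bullet> \<beta> < 0" and "k \<le> k'" and "k' \<le> m"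
  shows "pre I k' l \<bullet> \<beta> < 0"
  using assms(5,6)
proof (induction k' rule: dec_induct)
  case (step n)
  then have neg: "pre I n l \<bullet> \<beta> < 0" by simp
  define \<gamma> where "\<gamma> = run a I [0..<n] \<beta>"
  have \<gamma>: "\<gamma> \<in> \<Phi>" unfolding \<gamma>_def using step.prems assms(2) by (intro run_root) auto
  have \<beta>: "\<beta> = pre I n \<gamma>" by (simp add: \<gamma>_def)
  show ?case
  proof (cases "n \<in> I")
    case False
    have "- \<gamma> \<noteq> a n"
    proof
      assume "- \<gamma> = a n"
      then have "rt I n = - \<beta>" by (simp add: \<beta> rt_def flip: run_minus)
      then show False using fac_pos[OF assms(1), of n] step.prems False assms(3) by simp
    qed
    then have "l \<bullet> reflection (a n) (- \<gamma>) > 0"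
      using a_simple[of n "- \<gamma>"] \<gamma> neg step.prems uminus_root by (simp add: \<beta>)
    then show ?thesis using False by (simp add: \<beta> inner_reflection_left)
  qed (use neg in simp)
qed (use assms in simp)

text \<open>Makes the order of positions readable from signs: the letter at \<open>e\<close> creates
  the inversion \<open>rt I e\<close>, and by \<open>sign_mono\<close> it is present exactly from
  then on.\<close>

lemma fac_order:
  assumes "fac I" and "e < m" and "e \<notin> I" and "k \<le> m"
  shows "pre I k l \<bullet> rt I e < 0 \<longleftrightarrow> e < k"
proof
  have r: "rt I e \<in> \<Phi>" "l \<bullet> rt I e > 0" using assms rt_root fac_pos by auto
  show "pre I k l \<bullet> rt I e < 0" if "e < k"
  proof (rule sign_mono[OF assms(1) r, of "Suc e"])
    show "pre I (Suc e) l \<bullet> rt I e < 0"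
      using assms a_pos by (simp add: rt_def inner_reflection_left)
  qed (use that assms in auto)
  show "e < k" if "pre I k l \<bullet> rt I e < 0"
  proof (rule ccontr)
    assume "\<not> e < k"
    then have "pre I e l \<bullet> rt I e < 0"
      using sign_mono[OF assms(1) r that] assms(2) by simp
    then show False using a_pos[OF assms(2)] by (simp add: rt_def)
  qed
qed

text \<open>The left-hand side does not mention \<open>I\<close>: all facets use letters with the
  same roots, the inversions of \<rho>.\<close>

lemma fac_inversion:
  assumes "fac I" and "\<beta> \<in> \<Phi>"
  shows "(l \<bullet> \<beta> > 0 \<and> R l \<bullet> \<beta> < 0) \<longleftrightarrow> (\<exists>e<m. e \<notin> I \<and> rt I e = \<beta>)"
proof
  assume "l \<bullet> \<beta> > 0 \<and> R l \<bullet> \<beta> < 0"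
  then show "\<exists>e<m. e \<notin> I \<and> rt I e = \<beta>"
    using crossing[of m \<beta> I] assms by (simp add: fac_def)
next
  assume "\<exists>e<m. e \<notin> I \<and> rt I e = \<beta>"
  then show "l \<bullet> \<beta> > 0 \<and> R l \<bullet> \<beta> < 0"
    using fac_order[OF assms(1) _ _ order.refl] fac_pos[OF assms(1)] assms(1) by (metis fac_def)
qed

lemma R_root: "fac I \<Longrightarrow> \<beta> \<in> \<Phi> \<Longrightarrow> R l \<bullet> \<beta> \<noteq> 0"
  using run_l_root[of \<beta> "rev [0..<m]" I] by (simp add: fac_def lessThan_atLeast0)

text \<open>The word using both letters differs from each facet by one \<open>pre_remove\<close>,
  with the same reflection. The two cancel on prefixes containing both positions; in between one
  survives. The interval is half-open since the prefix of length \<open>k\<close> ends just before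
  \<open>k\<close>.\<close>

lemma flip:
  assumes "fac F" and "i \<in> F" and "e \<notin> F" and "e < m" and "rt F i = rt F e \<or> rt F i = - rt F e"
  defines "G \<equiv> insert e (F - {i})"
  shows "fac G"
    and "pre G k v = (if min i e < k \<and> k \<le> max i e then reflection (rt F e) (pre F k v) else pre F k v)"
    and "rt G k = (if min i e < k \<and> k \<le> max i e then reflection (rt F e) (rt F k) else rt F k)"
proof -
  have i: "i < m" using assms(1,2) by (auto simp: fac_def)
  have ne: "i \<noteq> e" using assms by auto
  have H: "G - {e} = F - {i}" using assms by auto
  have ri: "reflection (rt F i) = reflection (rt F e)" using assms(5) by auto
  \<comment> \<open>If \<open>i\<close> precedes \<open>e\<close>, the exchange negates the root of
    \<open>e\<close>, but its reflection stays the same.\<close>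
  have "reflection (rt G e) = reflection (rt F e)"
  proof (cases "e < i")
    case True
    then have "rt G e = rt F e" by (intro rt_cong) (auto simp: G_def)
    then show ?thesis by simp
  next
    case False
    have "rt G e = pre (F - {i}) e (a e)"
      unfolding rt_def using pre_cong[of e G "F - {i}"] by (auto simp: G_def)
    also have "\<dots> = reflection (rt F e) (rt F e)"
      using pre_remove[OF assms(2)] False ne ri by (simp add: rt_def)
    finally show ?thesis by simp
  qed
  then show *: "pre G k v = (if min i e < k \<and> k \<le> max i e then reflection (rt F e) (pre F k v) else pre F k v)"
    for k v
  proof -
    have "pre G k v = (if e < k then reflection (rt F e) (pre (F - {i}) k v) else pre (F - {i}) k v)"
      using pre_remove[of e G k v] H \<open>reflection (rt G e) = reflection (rt F e)\<close>
      by (auto simp: G_def)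
    then show ?thesis using pre_remove[OF assms(2), of k v] ri ne by auto
  qed
  show "rt G k = (if min i e < k \<and> k \<le> max i e then reflection (rt F e) (rt F k) else rt F k)"
    using *[of k "a k"] by (simp add: rt_def)
  have "pre G m = pre F m" using *[of m] i assms(4) by (intro ext) auto
  moreover have "card ({..<m} - G) = card ({..<m} - F)"
  proof -
    have "{..<m} - G = insert i ({..<m} - F - {e})" using i assms ne by (auto simp: G_def)
    also have "card \<dots> = Suc (card ({..<m} - F - {e}))"
      by (rule card_insert_disjoint) (use assms(2) in auto)
    also have "\<dots> = card ({..<m} - F)" by (rule card_Suc_Diff1) (use assms(3,4) in auto)
    finally show ?thesis .
  qed
  ultimately show "fac G" using assms by (auto simp: fac_def G_def)
qed

text \<open>As \<open>R\<close> is surjective, comparison with the common word of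
  \<open>F - {i}\<close> shows that \<open>rt F i\<close> and \<open>rt G e\<close> have the same
  reflection; such roots agree up to sign.\<close>

lemma flip_conv:
  assumes "fac F" and "fac G" and "i \<in> F" and "e \<notin> F" and G: "G = insert e (F - {i})"
  shows "rt F i = rt F e \<or> rt F i = - rt F e"
proof -
  have lt: "i < m" "e < m" using assms by (auto simp: fac_def)
  have H: "G - {e} = F - {i}" using assms by auto
  have "reflection (rt F i) (R v) = reflection (rt G e) (R v)" for v
    using pre_remove[OF assms(3), of m v] pre_remove[of e G m v] lt H assms
    by (simp add: fac_def)
  moreover have "\<exists>v. w = R v" for w
    using assms(1) run_rev_run[of a F "[0..<m]" w] by (metis fac_def)
  ultimately have eq: "reflection (rt F i) = reflection (rt G e)" by (metis ext)
  have roots: "rt F i \<in> \<Phi>" "rt G e \<in> \<Phi>" using rt_root lt by auto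
  then have Ge: "rt G e = rt F i \<or> rt G e = - rt F i"
    using reflection_eqD[OF eq] root_multiple by metis
  show ?thesis
  proof (cases "e < i")
    case True
    then have "rt G e = rt F e" by (intro rt_cong) (auto simp: G)
    then show ?thesis using Ge by auto
  next
    case False
    then have "i < e" using assms by (metis nat_neq_iff)
    have "rt G e = pre (F - {i}) e (a e)"
      unfolding rt_def using pre_cong[of e G "F - {i}"] by (auto simp: G)
    also have "\<dots> = reflection (rt F i) (rt F e)"
      using pre_remove[OF assms(3)] \<open>i < e\<close> by (simp add: rt_def)
    finally have "rt F e = reflection (rt F i) (rt G e)" by simp
    then show ?thesis using Ge by auto
  qed
qed

text \<open>\<open>pre F i l\<close> is positive on \<open>rt F i\<close> and, by
  \<open>fac_order\<close>, negative on \<open>rt F e\<close> exactly when \<open>e < i\<close>;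
  this fixes the sign.\<close>

lemma flip_order:
  assumes "fac F" and "i \<in> F" and "e \<notin> F" and "e < m" and "rt F i = rt F e \<or> rt F i = - rt F e"
  shows "rt F i = (if i < e then rt F e else - rt F e)"
proof -
  have i: "i < m" using assms by (auto simp: fac_def)
  have "pre F i l \<bullet> rt F i > 0" using a_pos[OF i] by (simp add: rt_def)
  moreover have "pre F i l \<bullet> rt F e < 0 \<longleftrightarrow> e < i" using fac_order assms i by simp
  ultimately show ?thesis using assms(2,3,5)
    by (metis inner_minus_right linorder_neqE_nat neg_0_less_iff_less not_less_iff_gr_or_eq)
qed

section \<open>Flips\<close>

lemma flip_order_sign:
  assumes "fac F" and "i \<in> F" and "e \<notin> F" and "e < m" and "rt F i = rt F e \<or> rt F i = - rt F e"
  shows "l \<bullet> rt F i > 0 \<longleftrightarrow> i < e" and "l \<bullet> rt F i < 0 \<longleftrightarrow> e < i"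
proof -
  have "i \<noteq> e" using assms(2,3) by auto
  then show "l \<bullet> rt F i > 0 \<longleftrightarrow> i < e" and "l \<bullet> rt F i < 0 \<longleftrightarrow> e < i"
    using flip_order[OF assms] fac_pos[OF assms(1,4,3)] by (cases "i < e"; simp)+
qed

definition edge :: "nat set \<Rightarrow> nat \<Rightarrow> nat \<Rightarrow> nat set \<Rightarrow> bool" where
  "edge F p n G \<longleftrightarrow> fac F \<and> fac G \<and> p \<in> F \<and> n \<notin> F \<and> p < n \<and> G = insert n (F - {p})"

lemma edgeD:
  assumes "edge F p n G"
  shows "n < m" and "rt F n = rt F p" and "l \<bullet> rt F p > 0" and "R l \<bullet> rt F p < 0"
    and "rt G k = (if p < k \<and> k \<le> n then reflection (rt F p) (rt F k) else rt F k)"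
proof -
  have e: "fac F" "fac G" "p \<in> F" "n \<notin> F" "p < n" "G = insert n (F - {p})"
    using assms by (auto simp: edge_def)
  show n: "n < m" using e by (auto simp: fac_def)
  have pm: "rt F p = rt F n \<or> rt F p = - rt F n" by (rule flip_conv[OF e(1-4,6)])
  then show rn: "rt F n = rt F p" using flip_order[OF e(1,3,4) n] e(5) by simp
  show "l \<bullet> rt F p > 0" using fac_pos[OF e(1) n e(4)] rn by simp
  show "R l \<bullet> rt F p < 0" using fac_inversion[OF e(1) rt_root[OF n]] e(4) n rn by metis
  show "rt G k = (if p < k \<and> k \<le> n then reflection (rt F p) (rt F k) else rt F k)"
    using flip(3)[OF e(1,3,4) n pm] e(5,6) rn by simp
qed

text \<open>Flippability in terms of roots: by \<open>flip\<close>, exchanging \<open>i\<close> with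
  such an \<open>e\<close> gives a facet, on whichever side of \<open>i\<close> it lies.\<close>

definition flp :: "nat set \<Rightarrow> nat \<Rightarrow> bool" where
  "flp F i \<longleftrightarrow> i \<in> F \<and> (\<exists>e<m. e \<notin> F \<and> (rt F i = rt F e \<or> rt F i = - rt F e))"

lemma flp_edge:
  assumes "edge F p n G"
  shows "flp F p" and "flp G n"
proof -
  have e: "fac F" "p \<in> F" "n \<notin> F" "p < n" "G = insert n (F - {p})"
    using assms by (auto simp: edge_def)
  note d = edgeD[OF assms]
  show "flp F p" unfolding flp_def using d(1,2) e by auto
  have "rt G n = - rt G p" using d(2) d(5)[of p] d(5)[of n] e by simp
  then show "flp G n" unfolding flp_def using d(1) e by (auto intro!: exI[of _ p])
qed

lemma edge_up:
  assumes "fac F" and "i \<in> F" and "l \<bullet> rt F i > 0" and "R l \<bullet> rt F i < 0"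
  obtains e where "edge F i e (insert e (F - {i}))"
proof -
  have i: "i < m" using assms by (auto simp: fac_def)
  obtain e where e: "e < m" "e \<notin> F" "rt F e = rt F i"
    using fac_inversion[OF assms(1) rt_root[OF i]] assms(3,4) by metis
  then have pm: "rt F i = rt F e \<or> rt F i = - rt F e" by simp
  have "i < e" using flip_order_sign(1)[OF assms(1,2) e(2,1) pm] assms(3) by simp
  then show ?thesis using that[of e] flip(1)[OF assms(1,2) e(2,1) pm] assms e
    by (simp add: edge_def)
qed

lemma edge_down:
  assumes "fac F" and "i \<in> F" and "l \<bullet> rt F i < 0" and "R l \<bullet> rt F i > 0"
  obtains e where "edge (insert e (F - {i})) e i F"
proof -
  have i: "i < m" using assms by (auto simp: fac_def)
  obtain e where e: "e < m" "e \<notin> F" "rt F e = - rt F i"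
    using fac_inversion[OF assms(1) uminus_root[OF rt_root[OF i]]] assms(3,4)
    by (metis inner_minus_right neg_0_less_iff_less neg_less_0_iff_less)
  then have pm: "rt F i = rt F e \<or> rt F i = - rt F e" by simp
  have "e < i" using flip_order_sign(2)[OF assms(1,2) e(2,1) pm] assms(3) by simp
  then show ?thesis using that[of e] flip(1)[OF assms(1,2) e(2,1) pm] assms e
    by (auto simp: edge_def)
qed

text \<open>By \<open>fac_inversion\<close>, flippability asks whether \<open>rt F i\<close> or its
  negative is an inversion of \<rho>, that is, whether \<open>l\<close> and \<open>R l\<close> have
  opposite signs on it.\<close>

lemma flp_iff:
  assumes "fac F"
  shows "flp F i \<longleftrightarrow> i \<in> F \<and> (l \<bullet> rt F i > 0 \<longleftrightarrow> R l \<bullet> rt F i < 0)"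
proof (cases "i \<in> F")
  case True
  then have i: "i < m" using assms by (auto simp: fac_def)
  note r = rt_root[OF i, of F]
  have ne: "l \<bullet> rt F i \<noteq> 0" "R l \<bullet> rt F i \<noteq> 0" using l_root[OF r] R_root[OF assms r] by auto
  have "(rt F i = rt F e) = (rt F e = rt F i)" "(rt F i = - rt F e) = (rt F e = - rt F i)" for e
    by auto
  then have "flp F i \<longleftrightarrow> (\<exists>e<m. e \<notin> F \<and> rt F e = rt F i) \<or> (\<exists>e<m. e \<notin> F \<and> rt F e = - rt F i)"
    using True unfolding flp_def by blast
  also have "\<dots> \<longleftrightarrow> (l \<bullet> rt F i > 0 \<longleftrightarrow> R l \<bullet> rt F i < 0)"
    using fac_inversion[OF assms r] fac_inversion[OF assms uminus_root[OF r]] ne by auto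
  finally show ?thesis using True by simp
qed (simp add: flp_def)

lemma fac_lt: "fac F \<Longrightarrow> i \<in> F \<Longrightarrow> i < m"
  by (auto simp: fac_def)

section \<open>Demazure products\<close>

lemma reflection_inject: "reflection b x = reflection b y \<longleftrightarrow> x = (y :: 'v)"
  by (metis reflection_involution)

text \<open>The lifting property of the Bruhat order.\<close>

lemma bruhat_reflection:
  assumes "bruhat \<Phi> l u z" and "j < m"
  shows "bruhat \<Phi> l (reflection (a j) u) z \<or> bruhat \<Phi> l (reflection (a j) u) (reflection (a j) z)"
  using assms(1)
proof (induction rule: converse_rtranclp_induct)
  case (step u y)
  then obtain b where b: "b \<in> \<Phi>" "l \<bullet> b > 0" "u \<bullet> b > 0" "y = reflection b u"
    by (auto simp: root_step_def)
  show ?case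
  \<comment> \<open>If \<open>b = a j\<close>, the step from \<open>u\<close> is the reflection
    itself. Otherwise the reflection keeps \<open>b\<close> positive, and the step can be conjugated
    by it.\<close>
  proof (cases "b = a j")
    case False
    have "reflection (a j) y = reflection (reflection (a j) b) (reflection (a j) u)"
      unfolding b(4) by (rule reflection_conjugate[OF linear_reflection]) simp
    then have "root_step \<Phi> l (reflection (a j) u) (reflection (a j) y)"
      using a_simple[OF assms(2) b(1,2) False] b(1,3) reflection_closed[OF a_root[OF assms(2)] b(1)]
      by (auto simp: root_step_def)
    then show ?thesis using step.IH by (meson converse_rtranclp_into_rtranclp)
  qed (use step.hyps b in simp)
qed simp

lemma root_step_a: "\<lbrakk>j < m; z \<bullet> a j > 0\<rbrakk> \<Longrightarrow> root_step \<Phi> l z (reflection (a j) z)"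
  using a_root a_pos by (auto simp: root_step_def)

text \<open>Reading \<open>js\<close>, the letters outside \<open>F\<close> form a reduced word and those in \<open>F - D\<close> would not increase
  the length: the word outside \<open>F\<close> computes the Demazure product of the letters outside \<open>D\<close>.\<close>

definition greedy :: "nat set \<Rightarrow> nat set \<Rightarrow> nat list \<Rightarrow> bool" where
  "greedy D F js \<longleftrightarrow> D \<subseteq> F \<and> (\<forall>xs j ys. js = xs @ j # ys \<longrightarrow>
     (if j \<in> F then j \<in> D \<or> run a F xs l \<bullet> a j < 0 else run a F xs l \<bullet> a j > 0))"

lemma greedy_snocD:
  assumes "greedy D F (js @ [j])"
  shows "greedy D F js"
    and "j \<in> F \<Longrightarrow> j \<notin> D \<Longrightarrow> run a F js l \<bullet> a j < 0"
    and "j \<notin> F \<Longrightarrow> run a F js l \<bullet> a j > 0"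
proof -
  have "D \<subseteq> F" and *: "js @ [j] = xs @ i # ys \<Longrightarrow>
      (if i \<in> F then i \<in> D \<or> run a F xs l \<bullet> a i < 0 else run a F xs l \<bullet> a i > 0)" for xs i ys
    using assms by (auto simp: greedy_def)
  then show "greedy D F js" unfolding greedy_def by (metis append.assoc append_Cons)
  show "j \<in> F \<Longrightarrow> j \<notin> D \<Longrightarrow> run a F js l \<bullet> a j < 0" and "j \<notin> F \<Longrightarrow> run a F js l \<bullet> a j > 0"
    using *[of js j "[]"] by auto
qed

text \<open>The greedy run is Bruhat-maximal among the runs avoiding \<open>D\<close>: lift along
  the last letter by \<open>bruhat_reflection\<close>; the greedy choice there supplies the step
  that may be missing.\<close>

lemma greedy_bruhat:
  assumes "greedy D F js" and "D \<subseteq> G" and "set js \<subseteq> {..<m}"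
  shows "bruhat \<Phi> l (run a G js l) (run a F js l)"
  using assms(1,3)
proof (induction js rule: rev_induct)
  case (snoc j js)
  let ?u = "run a G js l" and ?z = "run a F js l" and ?q = "reflection (a j)"
  have j: "j < m" using snoc.prems by simp
  have IH: "bruhat \<Phi> l ?u ?z" using snoc greedy_snocD(1)[OF snoc.prems(1)] by simp
  note q = bruhat_reflection[OF IH j]
  show ?case
  proof (cases "j \<in> F")
    case False
    then have step: "root_step \<Phi> l ?z (?q ?z)"
      using root_step_a[OF j] greedy_snocD(3)[OF snoc.prems(1)] by simp
    then show ?thesis using False IH q by (auto intro: rtranclp.rtrancl_into_rtrancl)
  next
    case True
    show ?thesis
    proof (cases "j \<in> G")
      case False
      then have "?z \<bullet> a j < 0" using greedy_snocD(2)[OF snoc.prems(1) True] assms(2) by auto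
      then have "root_step \<Phi> l (?q ?z) ?z"
        using root_step_a[OF j, of "?q ?z"] by (simp add: inner_reflection_left)
      then show ?thesis using True False q by (auto intro: rtranclp.rtrancl_into_rtrancl)
    qed (use True IH in simp)
  qed
qed simp

text \<open>If only \<open>F\<close> skipped the last letter, then before it the run of
  \<open>F\<close> would be strictly smaller under \<open>l\<close> than that of \<open>G\<close>,
  against \<open>greedy_bruhat\<close>. So the last letter is treated alike and can be
  cancelled.\<close>

lemma greedy_unique:
  assumes "greedy D F js" and "greedy D G js" and "set js \<subseteq> {..<m}"
    and "run a F js l = run a G js l"
  shows "F \<inter> set js = G \<inter> set js"
  using assms
proof (induction js rule: rev_induct)
  case (snoc j js)
  have j: "j < m" and js: "set js \<subseteq> {..<m}" using snoc.prems by auto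
  have no: False
    if F: "greedy D F (js @ [j])" and G: "greedy D G (js @ [j])" and "j \<in> F" "j \<notin> G"
      and eq: "run a F (js @ [j]) l = run a G (js @ [j]) l" for F G
  proof -
    have "D \<subseteq> F" using F by (simp add: greedy_def)
    then have "l \<bullet> run a G js l \<le> l \<bullet> run a F js l"
      using bruhat_decreases[OF greedy_bruhat[OF greedy_snocD(1)[OF G] _ js]] by simp
    moreover have "run a F js l = reflection (a j) (run a G js l)" using eq that by simp
    ultimately show False
      using reflection_decreases[OF a_pos[OF j] greedy_snocD(3)[OF G \<open>j \<notin> G\<close>]] by simp
  qed
  have iff: "j \<in> F \<longleftrightarrow> j \<in> G"
    using no[OF snoc.prems(1,2) _ _ snoc.prems(4)] no[OF snoc.prems(2,1) _ _ snoc.prems(4)[symmetric]]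
    by blast
  then have "run a F js l = run a G js l"
    using snoc.prems(4) by (cases "j \<in> F") (simp_all add: reflection_inject)
  then have "F \<inter> set js = G \<inter> set js"
    using snoc.IH greedy_snocD(1) snoc.prems js by blast
  then show ?case using iff by auto
qed simp

lemma upt_splitD:
  assumes "[0..<m] = xs @ j # ys"
  shows "xs = [0..<j]" and "ys = [Suc j..<m]" and "j < m"
proof -
  have "length xs < length [0..<m]" using assms by simp
  then have len: "length xs < m" by simp
  have j: "j = length xs" using arg_cong[OF assms, of "\<lambda>zs. zs ! length xs"] len by simp
  show "xs = [0..<j]" using arg_cong[OF assms, of "take j"] j len by simp
  show "ys = [Suc j..<m]" using arg_cong[OF assms, of "drop (Suc j)"] j by simp
  show "j < m" using j len by simp
qed

lemma positions: "set [0..<m] \<subseteq> {..<m}" "set (rev [0..<m]) \<subseteq> {..<m}"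
  by auto

text \<open>Pulled back through the prefix before \<open>j\<close>, the number
  \<open>R l \<bullet> rt F j\<close> becomes the one that \<open>greedy\<close> tests when the word
  is read from the right, negated if the letter is used.\<close>

lemma greedy_up:
  assumes "fac F" and "D \<subseteq> F" and "\<And>i. i \<in> F - D \<Longrightarrow> R l \<bullet> rt F i < 0"
  shows "greedy D F (rev [0..<m])"
  unfolding greedy_def
proof (intro conjI allI impI)
  fix xs j ys assume "rev [0..<m] = xs @ j # ys"
  then have js: "rev [0..<m] = xs @ j # ys" .
  have "[0..<m] = rev (rev [0..<m])" by simp
  also have "\<dots> = rev ys @ j # rev xs" unfolding js by simp
  finally have "[0..<m] = rev ys @ j # rev xs" .
  note s = upt_splitD[OF this]
  have ys: "ys = rev [0..<j]" using s(1) by (metis rev_rev_ident)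
  have "R l = run a F (rev [0..<m]) l" using assms(1) by (simp add: fac_def)
  also have "\<dots> = pre F j (if j \<in> F then run a F xs l else reflection (a j) (run a F xs l))"
    unfolding js ys by simp
  finally have "R l \<bullet> rt F j = (if j \<in> F then run a F xs l else reflection (a j) (run a F xs l)) \<bullet> a j"
    by (simp add: rt_def)
  then have R: "R l \<bullet> rt F j = (if j \<in> F then run a F xs l \<bullet> a j else - (run a F xs l \<bullet> a j))"
    by (simp add: inner_reflection_left)
  have "R l \<bullet> rt F j < 0" if "j \<notin> F"
    using fac_inversion[OF assms(1) rt_root[OF s(3)]] that s(3) by metis
  then show "if j \<in> F then j \<in> D \<or> run a F xs l \<bullet> a j < 0 else run a F xs l \<bullet> a j > 0"
    using R assms(3)[of j] by auto
qed (rule assms(2))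

lemma greedy_down:
  assumes "fac F" and "D \<subseteq> F" and "\<And>i. i \<in> F - D \<Longrightarrow> l \<bullet> rt F i < 0"
  shows "greedy D F [0..<m]"
  unfolding greedy_def
proof (intro conjI allI impI)
  fix xs j ys assume "[0..<m] = xs @ j # ys"
  note s = upt_splitD[OF this]
  have "run a F xs l \<bullet> a j = l \<bullet> rt F j" by (simp add: s(1) inner_run_left rt_def)
  then show "if j \<in> F then j \<in> D \<or> run a F xs l \<bullet> a j < 0 else run a F xs l \<bullet> a j > 0"
    using assms(3)[of j] fac_pos[OF assms(1) s(3)] by auto
qed (rule assms(2))

text \<open>No word avoiding \<open>D\<close> rises above \<open>\<rho>\<close>, i.e. the link of \<open>D\<close> is a sphere.\<close>

definition spherical :: "nat set \<Rightarrow> bool" where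
  "spherical D \<longleftrightarrow> (\<forall>H. D \<subseteq> H \<longrightarrow> l \<bullet> R l \<le> l \<bullet> pre H m l)"

lemma spherical_up:
  assumes "fac F" and "greedy D F (rev [0..<m])"
  shows "spherical D"
  unfolding spherical_def
  using bruhat_decreases[OF greedy_bruhat[OF assms(2) _ positions(2)]] assms(1)
  by (simp add: fac_def)

lemma spherical_down:
  assumes "fac F" and "greedy D F [0..<m]"
  shows "spherical D"
proof -
  \<comment> \<open>The two reading orders give mutually inverse isometries \<open>w\<close>, for
    which \<open>l \<bullet> w l\<close> is the same.\<close>
  have "l \<bullet> run a H [0..<m] l = l \<bullet> pre H m l" for H
    using inner_run_left[of a H "[0..<m]" l l] by (simp add: inner_commute)
  then show ?thesis unfolding spherical_def
    using bruhat_decreases[OF greedy_bruhat[OF assms(2) _ positions(1)]] assms(1)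
    by (simp add: fac_def)
qed

text \<open>If \<open>i\<close> is not flippable, then \<open>l\<close> and \<open>R l\<close> have
  the same sign on its root, so using the letter at \<open>i\<close> as well would rise above \<rho>
  while avoiding \<open>D\<close>.\<close>

lemma spherical_flp:
  assumes "spherical D" and "fac G" and "D \<subseteq> G" and "i \<in> G" and "i \<notin> D"
  shows "flp G i"
proof (rule ccontr)
  assume "\<not> flp G i"
  have i: "i < m" using fac_lt assms by blast
  note r = rt_root[OF i, of G]
  have "l \<bullet> reflection (rt G i) (R l) < l \<bullet> R l"
  proof (cases "l \<bullet> rt G i > 0")
    case True
    then have "R l \<bullet> rt G i > 0"
      using \<open>\<not> flp G i\<close> flp_iff[OF assms(2)] assms(4) R_root[OF assms(2) r] by force
    then show ?thesis using True reflection_decreases by blast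
  next
    case False
    then have "l \<bullet> - rt G i > 0" "R l \<bullet> - rt G i > 0"
      using \<open>\<not> flp G i\<close> flp_iff[OF assms(2)] assms(4) l_root[OF r] R_root[OF assms(2) r] by force+
    then show ?thesis using reflection_decreases[of l "- rt G i" "R l"] by simp
  qed
  moreover have "pre (G - {i}) m l = reflection (rt G i) (R l)"
    using pre_remove[OF assms(4)] i assms(2) by (simp add: fac_def)
  moreover have "D \<subseteq> G - {i}" using assms by auto
  ultimately show False using assms(1) unfolding spherical_def by (metis leD)
qed

section \<open>Uniqueness of greedy facets\<close>

lemma facet_Int: "fac F \<Longrightarrow> F \<inter> set [0..<m] = F"
  by (auto simp: fac_def)

lemma greedy_up_unique:
  assumes "fac F" "fac G" "greedy D F (rev [0..<m])" "greedy D G (rev [0..<m])"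
  shows "F = G"
proof -
  have "run a F (rev [0..<m]) l = run a G (rev [0..<m]) l" using assms(1,2) by (simp only: fac_def)
  from greedy_unique[OF assms(3,4) positions(2) this] show ?thesis
    using facet_Int[OF assms(1)] facet_Int[OF assms(2)] by simp
qed

lemma greedy_down_unique:
  assumes "fac F" "fac G" "greedy D F [0..<m]" "greedy D G [0..<m]"
  shows "F = G"
proof -
  have "pre F m (run a G [0..<m] l) = pre G m (run a G [0..<m] l)"
    using assms(1,2) by (simp only: fac_def)
  then have "pre F m (run a G [0..<m] l) = l" by (simp only: run_rev_run)
  then have "run a F [0..<m] l = run a G [0..<m] l" by (metis run_run_rev)
  from greedy_unique[OF assms(3,4) positions(1) this] show ?thesis
    using facet_Int[OF assms(1)] facet_Int[OF assms(2)] by simp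
qed

lemma card_diff_fac:
  assumes "fac F" and "fac G"
  shows "card (F - G) = card (G - F)"
proof -
  have fin: "finite F" "finite G" using assms finite_subset by (auto simp: fac_def)
  have "card F = m - N" if "fac F" for F
    using that card_Diff_subset[of F "{..<m}"] finite_subset[of F "{..<m}"] card_mono[of "{..<m}" F]
    by (auto simp: fac_def)
  then have "card F = card G" using assms by simp
  then show ?thesis using fin by (metis card_le_sym_Diff le_antisym order.refl)
qed

text \<open>The whole products agree and so do the parts from \<open>k\<close> on; the latter can be
  cancelled.\<close>

lemma pre_cong_suffix:
  assumes "fac F" and "fac G" and "k \<le> m" and "\<And>j. k \<le> j \<Longrightarrow> j \<in> F \<longleftrightarrow> j \<in> G"
  shows "pre F k = pre G k"
proof
  fix v
  have s: "rev [0..<m] = rev [k..<m] @ rev [0..<k]"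
    using assms(3) upt_add_eq_append[of 0 k "m - k"] by simp
  have e: "run a G (rev [k..<m]) = run a F (rev [k..<m])" by (rule run_cong) (use assms(4) in auto)
  have "pre F m (run a F [k..<m] v) = pre G m (run a F [k..<m] v)"
    using assms(1,2) by (simp only: fac_def)
  then show "pre F k v = pre G k v" unfolding s run_append e run_rev_run .
qed

end

section \<open>Falling paths in the absence of double roots\<close>

text \<open>Stated over a bare relation, so that edges split off at either end by simplification;
  \<open>awalk_iff_walk\<close> matches it with \<open>awalk\<close>.\<close>

primrec walk :: "('a \<Rightarrow> 'a \<Rightarrow> bool) \<Rightarrow> 'a \<Rightarrow> ('a \<times> 'a) list \<Rightarrow> 'a \<Rightarrow> bool" where
  "walk E u [] v \<longleftrightarrow> u = v"
| "walk E u (e # es) v \<longleftrightarrow> fst e = u \<and> E u (snd e) \<and> walk E (snd e) es v"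

lemma walk_snoc: "walk E u (es @ [e]) v \<longleftrightarrow> walk E u es (fst e) \<and> E (fst e) v \<and> snd e = v"
  by (induction es arbitrary: u) auto

lemma is_flip_iff: "is_flip I i J j \<longleftrightarrow> i \<in> I \<and> j \<notin> I \<and> J = insert j (I - {i})"
  unfolding is_flip_def by blast

lemma p_label_eq: "is_flip I i J j \<Longrightarrow> p_label (I, J) = i"
  unfolding p_label_def by (rule the_equality) (auto simp: is_flip_iff)

lemma n_label_eq: "is_flip I i J j \<Longrightarrow> n_label (I, J) = j"
  unfolding n_label_def by (rule the_equality) (auto simp: is_flip_iff)

locale double_root_free_word = reflection_word +
  assumes root_free: "\<lbrakk>fac F; flp F i; flp F j; rt F i = rt F j\<rbrakk> \<Longrightarrow> i = j"
begin

text \<open>If the root \<open>\<gamma>\<close> of \<open>x\<close> becomes \<open>- \<delta>\<close>, then \<open>\<beta>\<close> is a positive combination of \<open>\<gamma>\<close> and \<open>\<delta>\<close>. The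
  positions \<open>y\<close> and \<open>z\<close> outside the facets with roots \<open>\<gamma>\<close> and \<open>\<delta>\<close> cannot lie between \<open>p\<close> and \<open>n\<close>, so
  \<open>z < p < x < n < y\<close>. Then in the facet \<open>H\<close> obtained by flipping \<open>x\<close> to \<open>y\<close> the roots \<open>\<delta>\<close>, \<open>\<gamma>\<close>, \<open>\<theta>\<close> at
  \<open>z\<close>, \<open>x\<close>, \<open>n\<close> appear in an order violating the biconvexity of inversion sets.\<close>

lemma edge_pos:
  assumes e: "edge F p n G" and x: "x \<in> F" "x \<noteq> p" "flp F x" "flp G x"
    and pos: "l \<bullet> rt F x > 0"
  shows "l \<bullet> rt G x > 0"
proof (rule ccontr)
  assume neg: "\<not> ?thesis"
  have E: "fac F" "fac G" "p \<in> F" "n \<notin> F" "p < n" "G = insert n (F - {p})"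
    using e by (auto simp: edge_def)
  note n = edgeD(1)[OF e] and rn = edgeD(2)[OF e] and \<beta>pos = edgeD(3)[OF e] and rG = edgeD(5)[OF e]
  define \<beta> \<gamma> \<delta> where "\<beta> = rt F p" and "\<gamma> = rt F x" and "\<delta> = - rt G x"
  have xm: "x < m" using fac_lt E(1) x(1) by blast
  have xn: "x \<noteq> n" using x(1) E(4) by auto
  have roots: "\<gamma> \<in> \<Phi>" "\<delta> \<in> \<Phi>"
    using rt_root[OF xm] uminus_root by (auto simp: \<gamma>_def \<delta>_def)
  have \<gamma>\<beta>: "\<gamma> \<noteq> \<beta>"
    using root_free[OF E(1) x(3) flp_edge(1)[OF e]] x(2) by (auto simp: \<gamma>_def \<beta>_def)
  have \<delta>pos: "l \<bullet> \<delta> > 0" using neg l_root[OF roots(2)] by (simp add: \<delta>_def)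
  have px: "p < x" "x < n" using rG[of x] neg pos xn by (auto split: if_splits)
  have \<delta>: "reflection \<beta> \<gamma> = - \<delta>" using rG[of x] px by (simp add: \<beta>_def \<gamma>_def \<delta>_def)
  then have \<gamma>: "reflection \<beta> \<delta> = - \<gamma>" by (metis reflection_involution reflection_minus minus_minus)
  obtain y where y: "y < m" "y \<notin> F" "rt F y = \<gamma>"
    using fac_inversion[OF E(1) roots(1)] flp_iff[OF E(1), of x] x(3) pos by (auto simp: \<gamma>_def)
  have xy: "x < y"
    using flip_order_sign(1)[OF E(1) x(1) y(2,1)] y(3) pos by (simp add: \<gamma>_def)
  have "R l \<bullet> rt G x > 0"
    using flp_iff[OF E(2), of x] x(4) neg R_root[OF E(2) rt_root[OF xm, of G]] by auto
  then obtain z where z: "z < m" "z \<notin> G" "rt G z = \<delta>"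
    using fac_inversion[OF E(2) roots(2)] \<delta>pos by (auto simp: \<delta>_def)
  have xG: "x \<in> G" using x E by auto
  have zx: "z < x"
    using flip_order_sign(2)[OF E(2) xG z(2,1)] z(3) \<delta>pos by (simp add: \<delta>_def)
  have "z \<noteq> p"
  proof
    assume "z = p"
    then have "\<delta> = \<beta>" using z(3) rG[of p] by (simp add: \<beta>_def)
    then show False using \<gamma> \<gamma>\<beta> by simp
  qed
  then have zF: "z \<notin> F" using z E by auto
  have "n < y"
  proof (rule ccontr)
    assume "\<not> n < y"
    moreover have "y \<noteq> n" using y(3) rn \<gamma>\<beta> by (auto simp: \<beta>_def)
    ultimately have "y < n" by simp
    then have "rt G y = - \<delta>" using rG[of y] px xy y \<delta> by (simp add: \<beta>_def)
    moreover have "y \<notin> G" using y \<open>y \<noteq> n\<close> E by auto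
    ultimately show False using fac_pos[OF E(2) y(1)] \<delta>pos by simp
  qed
  have "z < p"
  proof (rule ccontr)
    assume "\<not> z < p"
    then have "reflection \<beta> (rt F z) = \<delta>" using rG[of z] z zx px \<open>z \<noteq> p\<close> by (simp add: \<beta>_def)
    then have "rt F z = - \<gamma>" using \<gamma> by (metis reflection_involution)
    then show False using fac_pos[OF E(1) z(1) zF] pos by (simp add: \<gamma>_def)
  qed
  then have Fz: "rt F z = \<delta>" using rG[of z] z by simp
  define H where "H = insert y (F - {x})"
  have pm: "rt F x = rt F y \<or> rt F x = - rt F y" using y by (simp add: \<gamma>_def)
  have H: "fac H" and rH: "\<And>k. rt H k = (if x < k \<and> k \<le> y then reflection \<gamma> (rt F k) else rt F k)"
    using flip(1,3)[OF E(1) x(1) y(2,1) pm] xy y(3) by (auto simp: H_def)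
  define \<theta> where "\<theta> = reflection \<gamma> \<beta>"
  have r: "rt H z = \<delta>" "rt H x = \<gamma>" "rt H n = \<theta>"
    using rH[of z] rH[of x] rH[of n] zx px \<open>n < y\<close> Fz rn by (auto simp: \<gamma>_def \<theta>_def \<beta>_def)
  have out: "z \<notin> H" "x \<notin> H" "n \<notin> H"
    using zF E(4) zx xy px \<open>n < y\<close> by (auto simp: H_def)
  \<comment> \<open>Coordinates in the plane of \<beta> and \<gamma>: \<open>c\<close> makes
    \<open>\<gamma> + \<delta>\<close> a multiple of \<beta>, and \<open>d\<close> expresses
    \<theta> through \<beta> and \<gamma>.\<close>
  define c d where "c = 2 * (\<gamma> \<bullet> \<beta>) / (\<beta> \<bullet> \<beta>)" and "d = 2 * (\<beta> \<bullet> \<gamma>) / (\<gamma> \<bullet> \<gamma>)"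
  have c: "c *\<^sub>R \<beta> = \<gamma> + \<delta>" using \<delta> by (simp add: reflection_def c_def algebra_simps)
  have "l \<bullet> (c *\<^sub>R \<beta>) > 0" using c pos \<delta>pos by (simp add: \<gamma>_def inner_add_right)
  then have cpos: "c > 0" using \<beta>pos by (simp add: \<beta>_def zero_less_mult_iff)
  have d: "\<theta> = \<beta> - d *\<^sub>R \<gamma>" by (simp add: \<theta>_def reflection_def d_def)
  have ineq: "c * (u \<bullet> \<theta>) = (1 - c * d) * (u \<bullet> \<gamma>) + u \<bullet> \<delta>" for u
  proof -
    have "c * (u \<bullet> \<theta>) = u \<bullet> (c *\<^sub>R \<beta>) - c * d * (u \<bullet> \<gamma>)" by (simp add: d inner_diff_right algebra_simps)
    then show ?thesis by (simp add: c inner_add_right algebra_simps)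
  qed
  let ?u = "pre H n l" and ?v = "pre H x l"
  have nm: "n \<le> m" "x \<le> m" using n xm by auto
  have 1: "?u \<bullet> \<delta> < 0" "?u \<bullet> \<gamma> < 0" "\<not> ?u \<bullet> \<theta> < 0"
    using fac_order[OF H z(1) out(1) nm(1)] fac_order[OF H xm out(2) nm(1)] fac_order[OF H n out(3) nm(1)]
      r zx px by auto
  have 2: "?v \<bullet> \<delta> < 0" "\<not> ?v \<bullet> \<gamma> < 0" "\<not> ?v \<bullet> \<theta> < 0"
    using fac_order[OF H z(1) out(1) nm(2)] fac_order[OF H xm out(2) nm(2)] fac_order[OF H n out(3) nm(2)]
      r zx px by auto
  show False
  \<comment> \<open>If this holds, \<theta> is a nonnegative combination of \<gamma> and \<delta>,
    which are inverted before \<open>n\<close> while \<theta> is not. Otherwise \<delta> is a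
    positive combination of \<gamma> and \<theta>, inverted before \<open>x\<close> while neither of
    them is.\<close>
  proof (cases "1 - c * d \<ge> 0")
    case True
    then have "(1 - c * d) * (?u \<bullet> \<gamma>) \<le> 0" using 1(2) by (simp add: mult_nonneg_nonpos)
    then have "c * (?u \<bullet> \<theta>) < 0" using ineq[of ?u] 1(1) by linarith
    then show False using 1(3) cpos by (simp add: mult_less_0_iff)
  next
    case False
    then have "(1 - c * d) * (?v \<bullet> \<gamma>) \<le> 0" using 2(2) by (simp add: mult_nonpos_nonneg)
    then have "c * (?v \<bullet> \<theta>) < 0" using ineq[of ?v] 2(1) by linarith
    then show False using 2(3) cpos by (simp add: mult_less_0_iff)
  qed
qed

text \<open>Decreasing flips outside \<open>insert x D\<close> lead from \<open>G\<close> to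
  \<open>I\<close> and lower the sum of the positions; \<open>edge_pos\<close> carries positivity at
  \<open>I\<close> back along them.\<close>

lemma link_pos:
  assumes I: "fac I" "D \<subseteq> I" "x \<in> I" "x \<notin> D"
    and up: "\<And>i. i \<in> I - D \<Longrightarrow> l \<bullet> rt I i > 0 \<and> R l \<bullet> rt I i < 0"
    and G: "fac G" "insert x D \<subseteq> G"
  shows "l \<bullet> rt G x > 0"
  using G
proof (induction "\<Sum>G" arbitrary: G rule: less_induct)
  case less
  \<comment> \<open>Sphericity makes \<open>x\<close> flippable in every facet met, as
    \<open>edge_pos\<close> requires.\<close>
  have sph: "spherical D" using spherical_up[OF I(1) greedy_up[OF I(1,2)]] up by blast
  have flpG: "flp G i" if "fac G" "insert x D \<subseteq> G" "i \<in> G - D" for G i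
    using spherical_flp[OF sph that(1)] that by auto
  show ?case
  proof (cases "\<exists>i\<in>G - insert x D. l \<bullet> rt G i < 0")
    case True
    then obtain i where i: "i \<in> G" "i \<notin> insert x D" "l \<bullet> rt G i < 0" by auto
    have "i < m" using fac_lt less.prems i by blast
    have "flp G i" using flpG less.prems i by blast
    then have "R l \<bullet> rt G i > 0"
      using flp_iff[OF less.prems(1)] i(3) R_root[OF less.prems(1) rt_root[OF \<open>i < m\<close>], of G] by force
    then obtain e where e: "edge (insert e (G - {i})) e i G"
      using edge_down less.prems i by blast
    define G' where "G' = insert e (G - {i})"
    have E: "e \<notin> G" "e < i" "fac G'"
      using e by (auto simp: edge_def G'_def)
    have sub: "insert x D \<subseteq> G'" using less.prems i by (auto simp: G'_def)
    have fin: "finite G" using less.prems finite_subset by (auto simp: fac_def)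
    have "\<Sum>G' = e + \<Sum>(G - {i})" using fin E by (simp add: G'_def)
    then have "\<Sum>G' < \<Sum>G" using sum.remove[OF fin i(1), of "\<lambda>x. x"] E by simp
    then have "l \<bullet> rt G' x > 0" using less.hyps E sub by blast
    moreover have "x \<in> G'" "x \<noteq> e" "flp G' x" "flp G x"
      using sub less.prems E flpG I(4) by auto
    ultimately show ?thesis using edge_pos e unfolding G'_def by blast
  next
    case False
    have "R l \<bullet> rt G i < 0" if "i \<in> G - insert x D" for i
      using flpG[OF less.prems, of i] flp_iff[OF less.prems(1), of i] False that
        l_root[OF rt_root[OF fac_lt[OF less.prems(1)]], of i G] by force
    \<comment> \<open>\<open>x\<close> joins the forbidden positions because the sign of its root in
      \<open>G\<close> is still unknown.\<close>
    then have "greedy (insert x D) G (rev [0..<m])" using greedy_up less.prems by blast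
    moreover have "greedy (insert x D) I (rev [0..<m])" using greedy_up[OF I(1), of "insert x D"] I up by blast
    ultimately have "G = I" using greedy_up_unique less.prems(1) I(1) by blast
    then show ?thesis using up[of x] I by blast
  qed
qed

text \<open>Dual to \<open>link_pos\<close>: increasing flips lead from \<open>G\<close> to
  \<open>J\<close>, and \<open>edge_pos\<close> is used contrapositively. The measure sums the
  complement, which such flips lower.\<close>

lemma link_neg:
  assumes J: "fac J" "D \<subseteq> J" "x \<in> J" "x \<notin> D"
    and down: "\<And>i. i \<in> J - D \<Longrightarrow> l \<bullet> rt J i < 0"
    and G: "fac G" "insert x D \<subseteq> G"
  shows "l \<bullet> rt G x < 0"
  using G
proof (induction "\<Sum>({..<m} - G)" arbitrary: G rule: less_induct)
  case less
  have sph: "spherical D" using spherical_down[OF J(1) greedy_down[OF J(1,2)]] down by blast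
  have flpG: "flp G i" if "fac G" "insert x D \<subseteq> G" "i \<in> G - D" for G i
    using spherical_flp[OF sph that(1)] that by auto
  show ?case
  proof (cases "\<exists>i\<in>G - insert x D. l \<bullet> rt G i > 0")
    case True
    then obtain i where i: "i \<in> G" "i \<notin> insert x D" "l \<bullet> rt G i > 0" by auto
    have "i < m" using fac_lt less.prems i by blast
    have "flp G i" using flpG less.prems i by blast
    then have "R l \<bullet> rt G i < 0"
      using flp_iff[OF less.prems(1)] i(3) by blast
    then obtain e where e: "edge G i e (insert e (G - {i}))"
      using edge_up less.prems i by blast
    define G' where "G' = insert e (G - {i})"
    have E: "e \<notin> G" "i < e" "fac G'" "e < m"
      using e edgeD(1)[OF e] by (auto simp: edge_def G'_def)
    have sub: "insert x D \<subseteq> G'" using less.prems i by (auto simp: G'_def)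
    have "{..<m} - G' = insert i (({..<m} - G) - {e})"
      using E i \<open>i < m\<close> by (auto simp: G'_def)
    then have "\<Sum>({..<m} - G') = i + \<Sum>(({..<m} - G) - {e})" using i E by simp
    then have "\<Sum>({..<m} - G') < \<Sum>({..<m} - G)"
      using sum.remove[of "{..<m} - G" e "\<lambda>x. x"] E by simp
    then have neg: "l \<bullet> rt G' x < 0" using less.hyps E sub by blast
    have xm: "x < m" using fac_lt[OF J(1,3)] .
    have "x \<in> G" "x \<noteq> i" "flp G x" "flp G' x"
      using sub less.prems E flpG J(4) i by auto
    then have "\<not> l \<bullet> rt G x > 0" using edge_pos[OF e] neg unfolding G'_def by force
    then show ?thesis using l_root[OF rt_root[OF xm], of G] by force
  next
    case False
    have "l \<bullet> rt G i < 0" if "i \<in> G - insert x D" for i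
      using False that l_root[OF rt_root[OF fac_lt[OF less.prems(1)]], of i G] by force
    then have "greedy (insert x D) G [0..<m]" using greedy_down less.prems by blast
    moreover have "greedy (insert x D) J [0..<m]" using greedy_down[OF J(1), of "insert x D"] J down by blast
    ultimately have "G = J" using greedy_down_unique less.prems(1) J(1) by blast
    then show ?thesis using down[of x] J by blast
  qed
qed

section \<open>Length and uniqueness of falling paths\<close>

abbreviation arc :: "nat set \<Rightarrow> nat set \<Rightarrow> bool" where
  "arc F G \<equiv> \<exists>p n. edge F p n G"

lemma edge_labels:
  assumes "edge F p n G"
  shows "p_label (F, G) = p" and "n_label (F, G) = n"
  using p_label_eq[of F p G n] n_label_eq[of F p G n] assms by (simp_all add: edge_def is_flip_iff)

text \<open>The last two conjuncts drive the induction on the last edge: agreement before all labels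
  gives the next label the same root in \<open>I\<close> as in the current facet, and the signs are
  the hypotheses of \<open>link_pos\<close>.\<close>

lemma p_falling_labels:
  assumes "walk arc I \<pi> J" and "fac I" and "sorted_wrt (\<ge>) (map p_label \<pi>)"
  shows "set (map p_label \<pi>) = I - J \<and> length \<pi> = card (I - J) \<and>
    (\<forall>i\<in>I - J. l \<bullet> rt I i > 0 \<and> R l \<bullet> rt I i < 0) \<and>
    (\<forall>k. (\<forall>i\<in>I - J. k < i) \<longrightarrow> (k \<in> I \<longleftrightarrow> k \<in> J))"
  using assms(1,3)
proof (induction \<pi> arbitrary: J rule: rev_induct)
  case (snoc e \<pi>)
  define K where "K = fst e"
  have w: "walk arc I \<pi> K" and e: "e = (K, J)"
    using snoc.prems(1) by (auto simp: walk_snoc K_def)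
  obtain p n where pn: "edge K p n J" using snoc.prems(1) by (auto simp: walk_snoc K_def)
  have E: "fac K" "fac J" "p \<in> K" "n \<notin> K" "p < n" "J = insert n (K - {p})"
    using pn by (auto simp: edge_def)
  have lab: "p_label e = p" using edge_labels[OF pn] e by simp
  have srt: "sorted_wrt (\<ge>) (map p_label \<pi>)" and le: "\<forall>q\<in>set (map p_label \<pi>). p \<le> q"
    using snoc.prems(2) lab by (auto simp: sorted_wrt_append)
  note IH = snoc.IH[OF w srt]
  have less: "p < q" if "q \<in> I - K" for q
    using le IH that E(3) by (metis DiffD2 le_neq_implies_less)
  have pI: "p \<in> I" using IH less E(3) by blast
  have rt: "rt I p = rt K p" by (rule rt_cong) (use IH less in \<open>meson less_trans\<close>)
  \<comment> \<open>With \<open>D\<close> the part of \<open>I\<close> never flipped out,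
    \<open>link_pos\<close> would make the root of a returning \<open>n\<close> positive in
    \<open>J\<close>, where it is \<open>- rt K p\<close>.\<close>
  have "n \<notin> I"
  proof
    assume nI: "n \<in> I"
    define D where "D = I - insert p (I - K)"
    have D: "D \<subseteq> I" "n \<notin> D" "insert n D \<subseteq> J" using E by (auto simp: D_def)
    have "l \<bullet> rt I i > 0 \<and> R l \<bullet> rt I i < 0" if "i \<in> I - D" for i
      using that IH edgeD(3,4)[OF pn] rt by (cases "i = p") (auto simp: D_def)
    then have "l \<bullet> rt J n > 0" using link_pos[OF assms(2) D(1) nI D(2) _ E(2) D(3)] by blast
    moreover have "rt J n = - rt K p" using edgeD(2)[OF pn] edgeD(5)[OF pn, of n] E(5) by simp
    ultimately show False using edgeD(3)[OF pn] by simp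
  qed
  then have IJ: "I - J = insert p (I - K)" using E pI by auto
  have "finite I" using assms(2) finite_subset by (auto simp: fac_def)
  then have "card (I - J) = Suc (card (I - K))" unfolding IJ using E(3) by simp
  moreover have "k \<in> I \<longleftrightarrow> k \<in> J" if "\<forall>i\<in>I - J. k < i" for k
  proof -
    have "k < p" and "\<forall>i\<in>I - K. k < i" using that IJ by auto
    then show ?thesis using IH E(5,6) by auto
  qed
  moreover have "l \<bullet> rt I i > 0 \<and> R l \<bullet> rt I i < 0" if "i \<in> I - J" for i
    using that IH edgeD(3,4)[OF pn] rt unfolding IJ by auto
  moreover have "set (map p_label (\<pi> @ [e])) = I - J" using IH lab unfolding IJ by simp
  moreover have "length \<pi> = card (I - K)" using IH by blast
  ultimately show ?case by simp
qed simp

lemma p_falling_unique: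
  assumes "walk arc I \<pi> J" and "walk arc I \<pi>' J" and "fac I"
    and "sorted_wrt (\<ge>) (map p_label \<pi>)" and "sorted_wrt (\<ge>) (map p_label \<pi>')"
  shows "\<pi> = \<pi>'"
  using assms(1,2,4,5)
proof (induction \<pi> arbitrary: J \<pi>' rule: rev_induct)
  case Nil
  then have "length \<pi>' = 0" using p_falling_labels[OF Nil.prems(2) assms(3) Nil.prems(4)] by simp
  then show ?case by simp
next
  case (snoc e \<pi>)
  note L = p_falling_labels[OF snoc.prems(1) assms(3) snoc.prems(3)]
  note L' = p_falling_labels[OF snoc.prems(2) assms(3) snoc.prems(4)]
  have "length (\<pi> @ [e]) = card (I - J)" "length \<pi>' = card (I - J)" using L L' by blast+
  then have "length \<pi>' = Suc (length \<pi>)" by simp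
  then obtain \<sigma> e' where s: "\<pi>' = \<sigma> @ [e']" by (cases \<pi>' rule: rev_cases) auto
  have last: "\<exists>p n. edge (fst e) p n J \<and> e = (fst e, J) \<and> p \<in> I - J \<and> (\<forall>i\<in>I - J. p \<le> i)"
    if w: "walk arc I (\<pi> @ [e]) J" and srt: "sorted_wrt (\<ge>) (map p_label (\<pi> @ [e]))" for \<pi> e
  proof -
    have e: "e = (fst e, J)" using w by (auto simp: walk_snoc prod_eq_iff)
    obtain p n where pn: "edge (fst e) p n J" using w by (auto simp: walk_snoc)
    have p: "p_label e = p" using edge_labels(1)[OF pn] e by simp
    have "set (map p_label (\<pi> @ [e])) = I - J" using p_falling_labels[OF w assms(3) srt] by blast
    moreover have "\<forall>i\<in>set (map p_label (\<pi> @ [e])). p \<le> i"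
      using srt p by (auto simp: sorted_wrt_append)
    moreover have "p \<in> set (map p_label (\<pi> @ [e]))" using p by simp
    ultimately show ?thesis using e pn by metis
  qed
  obtain p n where 1: "edge (fst e) p n J" "e = (fst e, J)" "p \<in> I - J" "\<forall>i\<in>I - J. p \<le> i"
    using last[OF snoc.prems(1,3)] by blast
  obtain p' n' where 2: "edge (fst e') p' n' J" "e' = (fst e', J)" "p' \<in> I - J" "\<forall>i\<in>I - J. p' \<le> i"
    using last[of \<sigma> e'] snoc.prems(2,4) s by blast
  have "p = p'" using 1(3,4) 2(3,4) by (meson le_antisym)
  have rtn: "rt J n = - rt J p" if "edge K p n J" for K p n
    using edgeD(2)[OF that] edgeD(5)[OF that, of n] edgeD(5)[OF that, of p] that by (simp add: edge_def)
  have "fac J" using 1(1) unfolding edge_def by blast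
  \<comment> \<open>Both edges give the entering position the root \<open>- rt J p\<close> in
    \<open>J\<close>.\<close>
  then have "n = n'"
    using root_free flp_edge(2)[OF 1(1)] flp_edge(2)[OF 2(1)] rtn[OF 1(1)] rtn[OF 2(1)] \<open>p = p'\<close> by metis
  have "K = insert p (J - {n})" if "edge K p n J" for K p n using that unfolding edge_def by blast
  then have "fst e = fst e'" using 1(1) 2(1) \<open>p = p'\<close> \<open>n = n'\<close> by metis
  then have "e = e'" using 1(2) 2(2) by metis
  moreover have "\<pi> = \<sigma>"
    using snoc.IH[of "fst e" \<sigma>] snoc.prems s \<open>fst e = fst e'\<close>
    by (simp add: walk_snoc sorted_wrt_append)
  ultimately show ?case using s by simp
qed

text \<open>Dual induction, on the first edge: labels now bound positions from above, so the facets
  agree after all labels.\<close>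

lemma n_falling_labels:
  assumes "walk arc I \<pi> J" and "fac J" and "fac I" and "sorted_wrt (\<ge>) (map n_label \<pi>)"
  shows "set (map n_label \<pi>) = J - I \<and> length \<pi> = card (J - I) \<and>
    (\<forall>i\<in>J - I. l \<bullet> rt J i < 0) \<and> (\<forall>k. (\<forall>i\<in>J - I. i < k) \<longrightarrow> (k \<in> I \<longleftrightarrow> k \<in> J))"
  using assms(1,3,4)
proof (induction \<pi> arbitrary: I)
  case (Cons e \<pi>)
  define K where "K = snd e"
  have w: "walk arc K \<pi> J" and e: "e = (I, K)"
    using Cons.prems(1) by (auto simp: K_def)
  obtain p n where pn: "edge I p n K" using Cons.prems(1) by (auto simp: K_def)
  have E: "fac I" "fac K" "p \<in> I" "n \<notin> I" "p < n" "K = insert n (I - {p})"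
    using pn by (auto simp: edge_def)
  have lab: "n_label e = n" using edge_labels[OF pn] e by simp
  have srt: "sorted_wrt (\<ge>) (map n_label \<pi>)" and le: "\<forall>q\<in>set (map n_label \<pi>). q \<le> n"
    using Cons.prems(3) lab by auto
  note IH = Cons.IH[OF w E(2) srt]
  have nK: "n \<in> K" using E by simp
  have less: "q < n" if "q \<in> J - K" for q
    using le IH that nK by (metis DiffD2 le_neq_implies_less)
  have nJ: "n \<in> J" using IH less nK by blast
  have "rt J n = rt K n"
  proof -
    \<comment> \<open>\<open>J\<close> and \<open>K\<close> may differ before \<open>n\<close>; the
      prefix products agree because the suffixes and the whole products do.\<close>
    have "pre J (Suc n) = pre K (Suc n)"
    proof (rule pre_cong_suffix[OF assms(2) E(2)])
      show "Suc n \<le> m" using edgeD(1)[OF pn] by simp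
      show "j \<in> J \<longleftrightarrow> j \<in> K" if "Suc n \<le> j" for j
        using IH less that by (meson less_le_trans less_SucI)
    qed
    from fun_cong[OF this, of "a n"] show ?thesis using nJ nK by (simp add: rt_def)
  qed
  also have "\<dots> = - rt I p" using edgeD(2)[OF pn] edgeD(5)[OF pn, of n] E(5) by simp
  finally have neg: "l \<bullet> rt J n < 0" using edgeD(3)[OF pn] by simp
  \<comment> \<open>If \<open>p\<close> came back, \<open>link_neg\<close> with \<open>D\<close> the
    part of \<open>J\<close> never flipped in would make its root negative in \<open>I\<close>,
    where an increasing flip removes it.\<close>
  have "p \<notin> J"
  proof
    assume pJ: "p \<in> J"
    define D where "D = J - insert n (J - K)"
    have "p \<notin> K" using E by auto
    then have D: "D \<subseteq> J" "p \<notin> D" "insert p D \<subseteq> I" using E by (auto simp: D_def)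
    have "l \<bullet> rt J i < 0" if "i \<in> J - D" for i
      using that IH neg by (cases "i = n") (auto simp: D_def)
    then have "l \<bullet> rt I p < 0" using link_neg[OF assms(2) D(1) pJ D(2) _ E(1) D(3)] by blast
    then show False using edgeD(3)[OF pn] by simp
  qed
  then have JI: "J - I = insert n (J - K)" using E nJ by auto
  have "finite J" using assms(2) finite_subset by (auto simp: fac_def)
  then have "card (J - I) = Suc (card (J - K))" unfolding JI using nK by simp
  moreover have "k \<in> I \<longleftrightarrow> k \<in> J" if "\<forall>i\<in>J - I. i < k" for k
  proof -
    have "n < k" and "\<forall>i\<in>J - K. i < k" using that JI by auto
    then show ?thesis using IH E(5,6) by auto
  qed
  moreover have "l \<bullet> rt J i < 0" if "i \<in> J - I" for i
    using that IH neg unfolding JI by auto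
  moreover have "set (map n_label (e # \<pi>)) = J - I" using IH lab unfolding JI by simp
  moreover have "length \<pi> = card (J - K)" using IH by blast
  ultimately show ?case by simp
qed simp

text \<open>The first edge is forced: it flips in the maximum of \<open>J - I\<close>, and the
  position flipped out has the same root in \<open>I\<close>.\<close>

lemma n_falling_unique:
  assumes "walk arc I \<pi> J" and "walk arc I \<pi>' J" and "fac I" and "fac J"
    and "sorted_wrt (\<ge>) (map n_label \<pi>)" and "sorted_wrt (\<ge>) (map n_label \<pi>')"
  shows "\<pi> = \<pi>'"
  using assms(1,2,3,5,6)
proof (induction \<pi> arbitrary: I \<pi>')
  case Nil
  then have "length \<pi>' = 0" using n_falling_labels[OF Nil.prems(2) assms(4) Nil.prems(3,5)] by simp
  then show ?case by simp
next
  case (Cons e \<pi>)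
  note L = n_falling_labels[OF Cons.prems(1) assms(4) Cons.prems(3,4)]
  note L' = n_falling_labels[OF Cons.prems(2) assms(4) Cons.prems(3,5)]
  have "length (e # \<pi>) = card (J - I)" "length \<pi>' = card (J - I)" using L L' by blast+
  then have "length \<pi>' = Suc (length \<pi>)" by simp
  then obtain e' \<sigma> where s: "\<pi>' = e' # \<sigma>" by (cases \<pi>') auto
  have first: "\<exists>p n. edge I p n (snd e) \<and> e = (I, snd e) \<and> n \<in> J - I \<and> (\<forall>i\<in>J - I. i \<le> n)"
    if w: "walk arc I (e # \<pi>) J" and srt: "sorted_wrt (\<ge>) (map n_label (e # \<pi>))" for \<pi> e
  proof -
    have e: "e = (I, snd e)" using w by (auto simp: prod_eq_iff)
    obtain p n where pn: "edge I p n (snd e)" using w by auto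
    have n: "n_label e = n" using edge_labels(2)[OF pn] e by simp
    have "set (map n_label (e # \<pi>)) = J - I"
      using n_falling_labels[OF w assms(4) Cons.prems(3) srt] by blast
    moreover have "\<forall>i\<in>set (map n_label (e # \<pi>)). i \<le> n" using srt n by auto
    moreover have "n \<in> set (map n_label (e # \<pi>))" using n by simp
    ultimately show ?thesis using e pn by metis
  qed
  obtain p n where 1: "edge I p n (snd e)" "e = (I, snd e)" "n \<in> J - I" "\<forall>i\<in>J - I. i \<le> n"
    using first[OF Cons.prems(1,4)] by blast
  obtain p' n' where 2: "edge I p' n' (snd e')" "e' = (I, snd e')" "n' \<in> J - I" "\<forall>i\<in>J - I. i \<le> n'"
    using first[of e' \<sigma>] Cons.prems(2,5) s by blast
  have "n = n'" using 1(3,4) 2(3,4) by (meson le_antisym)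
  then have "p = p'"
    using root_free[OF Cons.prems(3)] flp_edge(1)[OF 1(1)] flp_edge(1)[OF 2(1)]
      edgeD(2)[OF 1(1)] edgeD(2)[OF 2(1)] by metis
  have "snd e = snd e'" using 1(1) 2(1) \<open>p = p'\<close> \<open>n = n'\<close> by (simp add: edge_def)
  then have "e = e'" using 1(2) 2(2) by metis
  moreover have "\<pi> = \<sigma>"
  proof (rule Cons.IH)
    show "walk arc (snd e) \<pi> J" "walk arc (snd e) \<sigma> J"
      using Cons.prems(1,2) s \<open>snd e = snd e'\<close> by auto
    show "fac (snd e)" using 1(1) unfolding edge_def by blast
  qed (use Cons.prems(4,5) s in auto)
  ultimately show ?case using s by simp
qed

end

section \<open>Finite Coxeter systems\<close>

lemma nths_cong:
  assumes "\<And>i. i < length xs \<Longrightarrow> i \<in> A \<longleftrightarrow> i \<in> B"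
  shows "nths xs A = nths xs B"
  unfolding nths_def
  by (intro arg_cong[where f = "map fst"] filter_cong) (auto simp: set_zip assms)

lemma nths_lessThan_Suc:
  assumes "k < length Q"
  shows "nths Q ({..<Suc k} - I) = nths Q ({..<k} - I) @ (if k \<in> I then [] else [Q ! k])"
proof -
  have *: "nths Q ({..<j} - I) = nths (take j Q) (- I)" if "j \<le> length Q" for j
  proof -
    have "nths Q ({..<j} - I) = nths (take j Q @ drop j Q) ({..<j} - I)" by simp
    also have "\<dots> = nths (take j Q) ({..<j} - I) @ nths (drop j Q) {}"
      using that by (subst nths_append) (auto intro!: nths_cong simp: min_def)
    also have "nths (take j Q) ({..<j} - I) = nths (take j Q) (- I)" by (rule nths_cong) auto
    finally show ?thesis by simp
  qed
  show ?thesis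
    using *[of k] *[of "Suc k"] assms by (simp add: take_Suc_conv_app_nth nths_append)
qed

lemma awalk_iff_walk:
  assumes "tail G = fst" and "head G = snd"
  shows "pre_digraph.awalk G u \<pi> v \<longleftrightarrow> u \<in> verts G \<and> walk (\<lambda>x y. (x, y) \<in> arcs G) u \<pi> v"
proof -
  have "set \<pi> \<subseteq> arcs G \<and> pre_digraph.cas G u \<pi> v \<longleftrightarrow> walk (\<lambda>x y. (x, y) \<in> arcs G) u \<pi> v"
    by (induction \<pi> arbitrary: u) (auto simp: pre_digraph.cas.simps assms)
  then show ?thesis by (simp add: pre_digraph.awalk_def)
qed

context finite_coxeter_reflection_system
begin

section \<open>Positive roots and simple reflections\<close>

lemma act_one: "act \<one> = id"
proof
  fix x
  have "act \<one> (act \<one> x) = act \<one> x" using act_mult[of \<one> \<one>] by (metis comp_apply one_closed r_one)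
  then show "act \<one> x = id x"
    using orthogonal_transformation_inj[OF act_isometry[OF one_closed]] by (simp add: inj_eq)
qed

lemma finite_S: "finite S"
  using finite_subset[OF generators_closed finite_group] .

lemma inj_\<alpha>: "inj_on \<alpha> S"
  by (metis act_faithful generators_closed inj_on_def simple_reflection subsetD)

lemma word_prod_closed: "ws \<in> lists S \<Longrightarrow> word_prod W ws \<in> carrier W"
  using generated by blast

lemma act_word_prod:
  assumes "ws \<in> lists S"
  shows "act (word_prod W ws) = foldr (\<lambda>s. reflection (\<alpha> s)) ws"
  using assms
proof (induction ws)
  case Nil
  then show ?case by (simp add: word_prod_def act_one)
next
  case (Cons s ws)
  have "word_prod W (s # ws) = s \<otimes> word_prod W ws" by (simp add: word_prod_def)
  then show ?case
    using Cons act_mult[of s "word_prod W ws"] word_prod_closed[of ws] generators_closed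
    by (auto simp: simple_reflection)
qed

text \<open>Supplies the dominant vector \<open>l\<close>: the height functional on the simple
  roots, represented by a vector through the adjoint.\<close>

lemma height_functional: "\<exists>l. \<forall>s\<in>S. l \<bullet> \<alpha> s = 1"
proof -
  obtain g :: "'v \<Rightarrow> real" where g: "linear g" "\<forall>x\<in>\<alpha> ` S. g x = 1"
    using linear_independent_extend[OF simple_independent, of "\<lambda>_. 1"] by blast
  have "adjoint g 1 \<bullet> x = g x" for x
    using adjoint_works[OF g(1), of x 1] by (simp add: inner_commute)
  then show ?thesis using g(2) by (metis imageI)
qed

lemma coordinate_functional:
  assumes "t \<in> S"
  obtains g :: "'v \<Rightarrow> real" where "linear g" "g (\<alpha> t) = 1" "\<And>s. s \<in> S \<Longrightarrow> s \<noteq> t \<Longrightarrow> g (\<alpha> s) = 0"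
proof -
  obtain g :: "'v \<Rightarrow> real" where g: "linear g" "\<forall>x\<in>\<alpha> ` S. g x = (if x = \<alpha> t then 1 else 0)"
    using linear_independent_extend[OF simple_independent, of "\<lambda>x. if x = \<alpha> t then 1 else 0"] by blast
  moreover have "\<alpha> s \<noteq> \<alpha> t" if "s \<in> S" "s \<noteq> t" for s
    using inj_\<alpha> that assms by (auto dest: inj_onD)
  ultimately show ?thesis using that[of g] assms by auto
qed

lemma root_combination:
  assumes l: "\<forall>s\<in>S. l \<bullet> \<alpha> s = 1" and \<beta>: "\<beta> \<in> \<Phi>"
  shows "l \<bullet> \<beta> \<noteq> 0"
    and "l \<bullet> \<beta> > 0 \<Longrightarrow> \<exists>c. (\<forall>s\<in>S. 0 \<le> c s) \<and> \<beta> = (\<Sum>s\<in>S. c s *\<^sub>R \<alpha> s)"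
proof -
  obtain c where c: "\<forall>s\<in>S. 0 \<le> c s"
      "\<beta> = (\<Sum>s\<in>S. c s *\<^sub>R \<alpha> s) \<or> \<beta> = - (\<Sum>s\<in>S. c s *\<^sub>R \<alpha> s)"
    using simple_sign[OF \<beta>] by blast
  have sum: "l \<bullet> (\<Sum>s\<in>S. c s *\<^sub>R \<alpha> s) = sum c S" using l by (simp add: inner_sum_right)
  show "l \<bullet> \<beta> \<noteq> 0"
  proof
    assume "l \<bullet> \<beta> = 0"
    then have "sum c S = 0" using c(2) sum by auto
    then have "\<forall>s\<in>S. c s = 0" using c(1) finite_S by (simp add: sum_nonneg_eq_0_iff)
    then have "\<beta> = 0" using c(2) by auto
    then show False using root_nonzero \<beta> by simp
  qed
  assume "l \<bullet> \<beta> > 0"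
  moreover have "sum c S \<ge> 0" using c(1) by (simp add: sum_nonneg)
  ultimately have "\<beta> = (\<Sum>s\<in>S. c s *\<^sub>R \<alpha> s)" using c(2) sum by auto
  then show "\<exists>c. (\<forall>s\<in>S. 0 \<le> c s) \<and> \<beta> = (\<Sum>s\<in>S. c s *\<^sub>R \<alpha> s)" using c(1) by blast
qed

lemma reflection_closed: "\<lbrakk>\<beta> \<in> \<Phi>; \<gamma> \<in> \<Phi>\<rbrakk> \<Longrightarrow> reflection \<beta> \<gamma> \<in> \<Phi>"
  using root_reflection root_stable by metis

text \<open>The reflection alters only the coefficient at \<open>s\<close>. If the image were
  negative, all other coefficients of \<beta> would vanish, leaving \<open>\<alpha> s\<close> or its
  negative.\<close>

lemma simple_reflection_pos:
  assumes l: "\<forall>s\<in>S. l \<bullet> \<alpha> s = 1" and s: "s \<in> S"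
    and \<beta>: "\<beta> \<in> \<Phi>" "l \<bullet> \<beta> > 0" "\<beta> \<noteq> \<alpha> s"
  shows "l \<bullet> reflection (\<alpha> s) \<beta> > 0"
proof (rule ccontr)
  assume neg: "\<not> ?thesis"
  let ?\<gamma> = "- reflection (\<alpha> s) \<beta>"
  have r: "reflection (\<alpha> s) \<beta> \<in> \<Phi>" using reflection_closed simple_root s \<beta> by blast
  then have \<gamma>: "?\<gamma> \<in> \<Phi>" using reflection_closed[OF r r] by simp
  have "l \<bullet> ?\<gamma> > 0" using neg root_combination(1)[OF l r] by simp
  then obtain d where d: "\<forall>t\<in>S. 0 \<le> d t" "?\<gamma> = (\<Sum>t\<in>S. d t *\<^sub>R \<alpha> t)"
    using root_combination(2)[OF l \<gamma>] by blast
  obtain c where c: "\<forall>t\<in>S. 0 \<le> c t" "\<beta> = (\<Sum>t\<in>S. c t *\<^sub>R \<alpha> t)"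
    using root_combination(2)[OF l \<beta>(1,2)] by blast
  have "c t = 0" if t: "t \<in> S" "t \<noteq> s" for t
  proof -
    obtain g :: "'v \<Rightarrow> real" where g: "linear g" "g (\<alpha> t) = 1" "\<And>u. u \<in> S \<Longrightarrow> u \<noteq> t \<Longrightarrow> g (\<alpha> u) = 0"
      using coordinate_functional[OF t(1)] by blast
    have coord: "g (\<Sum>u\<in>S. f u *\<^sub>R \<alpha> u) = f t" for f
    proof -
      have "g (\<Sum>u\<in>S. f u *\<^sub>R \<alpha> u) = (\<Sum>u\<in>S. f u * g (\<alpha> u))"
        using g(1) by (simp add: linear_sum linear_scale)
      also have "\<dots> = (\<Sum>u\<in>S. if u = t then f t else 0)"
        by (rule sum.cong) (auto simp: g(2,3))
      finally show ?thesis using finite_S t(1) by simp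
    qed
    have "g ?\<gamma> = - g \<beta>"
      using g(1) g(3)[OF s] t(2) by (simp add: reflection_def linear_diff linear_scale linear_neg)
    then have "d t = - c t" using coord[of d] coord[of c] d(2) c(2) by simp
    then show ?thesis using d(1) c(1) t(1) by force
  qed
  then have "\<beta> = (\<Sum>t\<in>S. if t = s then c s *\<^sub>R \<alpha> s else 0)"
    unfolding c(2) by (intro sum.cong) auto
  then have "\<beta> = c s *\<^sub>R \<alpha> s" using finite_S s by simp
  then have "\<beta> \<in> \<Phi> \<inter> span {\<alpha> s}" using \<beta>(1) by (simp add: span_base span_scale)
  then have "\<beta> = - \<alpha> s" using root_line[OF simple_root[OF s]] \<beta>(3) by auto
  then show False using \<beta>(2) l s by simp
qed

section \<open>Transfer to subword complexes\<close>

lemma act_subword: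
  assumes "set Q \<subseteq> S" and "k \<le> length Q"
  shows "run (\<lambda>k. \<alpha> (Q ! k)) I (rev [0..<k]) = act (word_prod W (nths Q ({..<k} - I)))"
proof -
  have in_S: "nths Q A \<in> lists S" for A using set_nths_subset[of Q A] assms(1) by auto
  have "run (\<lambda>k. \<alpha> (Q ! k)) I (rev [0..<k]) v = foldr (\<lambda>s. reflection (\<alpha> s)) (nths Q ({..<k} - I)) v" for v
    using assms(2) by (induction k arbitrary: v) (simp_all add: nths_lessThan_Suc)
  then show ?thesis using act_word_prod[OF in_S] by (simp add: fun_eq_iff)
qed

text \<open>Faithfulness turns equality of operators into an expression of \<rho>, so
  \<open>minimal\<close> reduces to the definition of \<open>coxeter_length\<close>.\<close>

lemma reflection_word_subword:
  assumes Q: "set Q \<subseteq> S" and \<rho>: "\<rho> \<in> carrier W" and l: "\<forall>s\<in>S. l \<bullet> \<alpha> s = 1"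
  shows "reflection_word \<Phi> l (length Q) (\<lambda>k. \<alpha> (Q ! k)) (act \<rho>) (coxeter_length W S \<rho>)"
proof
  fix \<beta> \<gamma> :: 'v and c :: real and k :: nat and I :: "nat set"
  show "l \<bullet> \<beta> \<noteq> 0" if "\<beta> \<in> \<Phi>" using root_combination(1)[OF l that] .
  show "reflection \<beta> \<gamma> \<in> \<Phi>" if "\<beta> \<in> \<Phi>" "\<gamma> \<in> \<Phi>" using reflection_closed that .
  show "c *\<^sub>R \<beta> = \<beta> \<or> c *\<^sub>R \<beta> = - \<beta>" if "\<beta> \<in> \<Phi>" "c *\<^sub>R \<beta> \<in> \<Phi>"
    using root_line[OF that(1)] that(2) span_scale[OF span_base[of \<beta> "{\<beta>}"], of c] by auto
  assume "k < length Q"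
  then have k: "Q ! k \<in> S" using Q by auto
  show "\<alpha> (Q ! k) \<in> \<Phi>" "l \<bullet> \<alpha> (Q ! k) > 0" using simple_root[OF k] l k by auto
  show "l \<bullet> reflection (\<alpha> (Q ! k)) \<beta> > 0" if "\<beta> \<in> \<Phi>" "l \<bullet> \<beta> > 0" "\<beta> \<noteq> \<alpha> (Q ! k)"
    using simple_reflection_pos[OF l k that] .
next
  fix I assume I: "I \<subseteq> {..<length Q}"
    and run: "run (\<lambda>k. \<alpha> (Q ! k)) I (rev [0..<length Q]) = act \<rho>"
  let ?ws = "nths Q ({..<length Q} - I)"
  have ws: "?ws \<in> lists S" using set_nths_subset[of Q] Q by fastforce
  have "word_prod W ?ws = \<rho>"
    using run act_subword[OF Q order.refl, of I] act_faithful word_prod_closed[OF ws] \<rho>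
    by (auto dest: inj_onD)
  then have "coxeter_length W S \<rho> \<le> length ?ws"
    unfolding coxeter_length_def using ws by (intro Least_le) blast
  also have "length ?ws = card ({..<length Q} - I)"
    by (simp add: length_nths) (rule arg_cong[where f = card], auto)
  finally show "coxeter_length W S \<rho> \<le> card ({..<length Q} - I)" .
qed

lemma sc_facets_iff:
  assumes Q: "set Q \<subseteq> S" and \<rho>: "\<rho> \<in> carrier W"
  shows "I \<in> sc_facets W S Q \<rho> \<longleftrightarrow> I \<subseteq> {..<length Q} \<and>
    run (\<lambda>k. \<alpha> (Q ! k)) I (rev [0..<length Q]) = act \<rho> \<and>
    card ({..<length Q} - I) = coxeter_length W S \<rho>"
proof -
  let ?ws = "nths Q ({..<length Q} - I)"
  have ws: "?ws \<in> lists S" using set_nths_subset[of Q] Q by fastforce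
  have "word_prod W ?ws = \<rho> \<longleftrightarrow> act (word_prod W ?ws) = act \<rho>"
    using act_faithful word_prod_closed[OF ws] \<rho> by (auto dest: inj_onD)
  moreover have "length ?ws = card ({..<length Q} - I)"
    by (simp add: length_nths) (rule arg_cong[where f = card], auto)
  ultimately show ?thesis
    using ws by (simp add: sc_facets_def reduced_expression_def act_subword[OF Q order.refl])
qed

end

theorem theorem5p4:
  fixes W :: "('w, 'b) monoid_scheme"
    and S :: "'w set"
    and act :: "'w \<Rightarrow> 'v::euclidean_space \<Rightarrow> 'v"
    and \<Phi> :: "'v set"
    and \<alpha> :: "'w \<Rightarrow> 'v"
    and Q :: "'w list"
    and \<rho> :: "'w"
    and I J :: "nat set"
  assumes "finite_coxeter_reflection_system W S act \<Phi> \<alpha>"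
    and "set Q \<subseteq> S"
    and "\<rho> \<in> carrier W"
    and "double_root_free W S act \<alpha> Q \<rho>"
    and "I \<in> sc_facets W S Q \<rho>"
    and "J \<in> sc_facets W S Q \<rho>"
  shows
    "((\<exists>\<^sub>\<le>\<^sub>1 \<pi>. p_falling_path W S Q \<rho> I \<pi> J) \<and>
      (\<forall>\<pi>. p_falling_path W S Q \<rho> I \<pi> J \<longrightarrow>
         length \<pi> = card (I - J) \<and> length \<pi> = card (J - I))) \<and>
     ((\<exists>\<^sub>\<le>\<^sub>1 \<pi>. n_falling_path W S Q \<rho> I \<pi> J) \<and>
      (\<forall>\<pi>. n_falling_path W S Q \<rho> I \<pi> J \<longrightarrow>
         length \<pi> = card (I - J) \<and> length \<pi> = card (J - I)))"
proof -
  interpret finite_coxeter_reflection_system W S act \<Phi> \<alpha> by fact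
  obtain l where l: "\<forall>s\<in>S. l \<bullet> \<alpha> s = 1" using height_functional by blast
  interpret reflection_word \<Phi> l "length Q" "\<lambda>k. \<alpha> (Q ! k)" "act \<rho>" "coxeter_length W S \<rho>"
    by (rule reflection_word_subword[OF assms(2,3) l])
  have fac: "F \<in> sc_facets W S Q \<rho> \<longleftrightarrow> fac F" for F
    unfolding fac_def sc_facets_iff[OF assms(2,3)] ..
  have rt: "root_function W act \<alpha> Q F k = rt F k" if "k < length Q" for F k
    using act_subword[OF assms(2), of k F] that by (simp add: root_function_def rt_def)
  interpret double_root_free_word \<Phi> l "length Q" "\<lambda>k. \<alpha> (Q ! k)" "act \<rho>" "coxeter_length W S \<rho>"
  proof
    fix F i j assume F: "fac F" and i: "flp F i" and j: "flp F j" and eq: "rt F i = rt F j"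
    \<comment> \<open>Exchanging positions with equal or opposite roots gives an adjacent facet, so
      a double root in terms of \<open>flp\<close> is one of the complex.\<close>
    have "flippable W S Q \<rho> F i" if i: "flp F i" for i
    proof -
      obtain e where e: "i \<in> F" "e < length Q" "e \<notin> F" "rt F i = rt F e \<or> rt F i = - rt F e"
        using i by (auto simp: flp_def)
      then show ?thesis using flip(1)[OF F e(1,3,2,4)] fac by (auto simp: flippable_def is_flip_iff)
    qed
    moreover have "i < length Q" "j < length Q" using fac_lt[OF F] i j by (auto simp: flp_def)
    ultimately show "i = j"
      using assms(4) F i j eq fac rt unfolding has_double_root_def by metis
  qed
  have arcs: "(\<lambda>F G. (F, G) \<in> arcs (increasing_flip_graph W S Q \<rho>)) = arc"
    by (auto simp: fun_eq_iff increasing_flip_graph_def fac is_flip_iff edge_def)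
  have walk: "pre_digraph.awalk (increasing_flip_graph W S Q \<rho>) I \<pi> J \<longleftrightarrow> walk arc I \<pi> J" for \<pi>
    using awalk_iff_walk[of "increasing_flip_graph W S Q \<rho>"] assms(5)
    by (simp add: arcs) (simp add: increasing_flip_graph_def)
  have I: "fac I" and J: "fac J" using assms(5,6) fac by auto
  have "\<exists>\<^sub>\<le>\<^sub>1 \<pi>. p_falling_path W S Q \<rho> I \<pi> J" "\<exists>\<^sub>\<le>\<^sub>1 \<pi>. n_falling_path W S Q \<rho> I \<pi> J"
    unfolding Uniq_def falling_path_def walk
    using p_falling_unique[OF _ _ I] n_falling_unique[OF _ _ I J] by blast+
  moreover have "length \<pi> = card (I - J)" if "p_falling_path W S Q \<rho> I \<pi> J" for \<pi>
    using that p_falling_labels[OF _ I] unfolding falling_path_def walk by blast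
  moreover have "length \<pi> = card (J - I)" if "n_falling_path W S Q \<rho> I \<pi> J" for \<pi>
    using that n_falling_labels[OF _ J I] unfolding falling_path_def walk by blast
  ultimately show ?thesis using card_diff_fac[OF I J] by simp
qed

end
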